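(* Let $0<d<\pi/2$, $\mathscr{D}_d=\{\zeta\in\mathbb{C}:|\Im\zeta|<d\}$, and let $i\in\{2,3\}$, with $\psi_2(t)=e^t$, $\psi_3(t)=\operatorname{arcsinh}(e^t)$, $E_2(z;\alpha,\beta)=z^{\alpha-1}(1+z^2)^{-(\alpha+\beta)/2}$, $E_3(z;\alpha,\beta)=\left(\frac{z}{1+z}\right)^{\alpha-1}e^{-\beta z}$. Assume $f$ is analytic on $\psi_i(\mathscr{D}_d)$ and there are constants $K,\alpha,\beta>0$ with $|f(z)|\le K|E_i(z;\alpha,\beta)|$ for all $z\in\psi_i(\mathscr{D}_d)$. Let $\mu=\min\{\alpha,\beta\}$, let $n$ be a positive integer, $h=\sqrt{2\pi d/(\mu n)}$, and let $M=n$, $N=\lceil\alpha n/\beta\rceil$ if $\mu=\alpha$, and $N=n$, $M=\lceil\beta n/\alpha\rceil$ if $\mu=\beta$. Then \[ \left|\int_{0}^{\infty} f(t)\,dt-h\sum_{k=-M}^{N} f(\psi_i(kh))\psi_i'(kh)\right|\le C_i\,e^{-\sqrt{2\pi d\mu n}}, \] where \[ C_2=\frac{2K}{\mu}\left\{\frac{2}{(1-e^{-\sqrt{2\pi d\mu}})(\cos d)^{(\alpha+\beta)/2}}+1\right\},\quad C_3=\frac{2K}{\mu}\left\{\frac{2^{1+\beta/2}c_{\alpha,d}}{(1-e^{-\sqrt{2\pi d\mu}})(\cos d)^{(\alpha+\beta)/2}}+2^{(1-\alpha+|1-\alpha|)/2}\right\}, \] and $c_{\alpha,d}=\{2(1+1/\cos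 d)\}^{(1-\alpha)/2}$ if $0<\alpha<1$, $c_{\alpha,d}=2^{(\alpha-1)/2}$ if $\alpha\ge 1$.
   Context: $\psi_i(\mathscr{D}_d)$ is the image of the strip under $\psi_i$. Complex powers use principal branches. *)

theory Defs
  imports "HOL-Analysis.Analysis"
begin

definition strip :: "real \<Rightarrow> complex set" where
  "strip d = {z. \<bar>Im z\<bar> < d}"

definition psi :: "nat \<Rightarrow> complex \<Rightarrow> complex" where
  "psi i z = (if i = 2 then exp z else arsinh (exp z))"

definition E :: "nat \<Rightarrow> complex \<Rightarrow> real \<Rightarrow> real \<Rightarrow> complex" where
  "E i z \<alpha> \<beta> =
     (if i = 2 then z powr (of_real (\<alpha> - 1)) * (1 + z\<^sup>2) powr (of_real (- (\<alpha> + \<beta>) / 2))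
      else (z / (1 + z)) powr (of_real (\<alpha> - 1)) * exp (- of_real \<beta> * z))"

definition c_ad :: "real \<Rightarrow> real \<Rightarrow> real" where
  "c_ad \<alpha> d = (if \<alpha> < 1 then (2 * (1 + 1 / cos d)) powr ((1 - \<alpha>) / 2) else 2 powr ((\<alpha> - 1) / 2))"

definition C_const :: "nat \<Rightarrow> real \<Rightarrow> real \<Rightarrow> real \<Rightarrow> real \<Rightarrow> real" where
  "C_const i K \<alpha> \<beta> d =
     (let \<mu> = min \<alpha> \<beta> in
      if i = 2 then
        2 * K / \<mu> * (2 / ((1 - exp (- sqrt (2 * pi * d * \<mu>))) * cos d powr ((\<alpha> + \<beta>) / 2)) + 1)
      else
        2 * K / \<mu> * (2 powr (1 + \<beta> / 2) * c_ad \<alpha> d /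
             ((1 - exp (- sqrt (2 * pi * d * \<mu>))) * cos d powr ((\<alpha> + \<beta>) / 2))
           + 2 powr ((1 - \<alpha> + \<bar>1 - \<alpha>\<bar>) / 2)))"

end

theory Submission
  imports Defs "HOL-Complex_Analysis.Residue_Theorem"
begin

text \<open>
  Substituting \<open>t = \<psi>(x)\<close> turns the integral into that of \<open>F = (f \<circ> \<psi>) \<psi>'\<close> over the real line.
  On the strip \<open>F\<close> is bounded by a multiple of \<open>e\<^sup>\<alpha>\<^sup>x\<close> for \<open>x \<le> 0\<close> and \<open>e\<^sup>-\<^sup>\<beta>\<^sup>x\<close> for \<open>x > 0\<close>.
  With \<open>q = exp (2\<pi>iz/h)\<close>, the function \<open>F q / (1 - q)\<close> has simple poles at the nodes \<open>kh\<close>; it is small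
  on the upper edge of the strip, and on the lower edge it is \<open>- F\<close> up to a small error. The residue
  theorem on a rectangle whose vertical sides lie midway between two nodes therefore bounds the
  discretization error by \<open>exp (-2\<pi>d/h)\<close> times the integral of the majorant over both edges, and
  comparing the tails of the trapezoidal sum with the integral of the majorant bounds the
  truncation error. The choice of \<open>h\<close>, \<open>M\<close>, \<open>N\<close> balances the two.

  For \<open>\<psi>\<^sub>3\<close> put \<open>z = arsinh w\<close> with \<open>w = e\<^sup>\<zeta>\<close>, so \<open>\<psi>\<^sub>3' = tanh z\<close>. The factor \<open>z/(1 + z)\<close> is comparable to
  \<open>tanh z\<close> up to the constant in \<open>c_ad\<close>, and \<open>(1 + |w|\<^sup>2) cos d \<le> |1 + w\<^sup>2| = |cosh z|\<^sup>2\<close> controls the rest.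
\<close>

subsection \<open>The trapezoidal rule on a rectangle\<close>

lemma contour_integral_linepath_horizontal:
  assumes "a < b"
  shows "contour_integral (linepath (Complex a c) (Complex b c)) f =
           integral {a..b} (\<lambda>x. f (Complex x c))"
proof -
  let ?z = "Complex a c" and ?z' = "Complex b c"
  have "contour_integral (linepath ?z ?z') f =
         (?z' - ?z) * integral {0..1} (\<lambda>x. f (linepath ?z ?z' x))"
    by (simp add: contour_integral_integral)
  also have "?z' - ?z = of_real (b - a)"
    by (simp add: complex_eq_iff)
  also have "integral {0..1} (\<lambda>x. f (linepath ?z ?z' x)) =
             integral {0..1} (\<lambda>x. f (Complex (linepath a b x) c))"
    by (simp add: linepath_def Complex_eq scaleR_conv_of_real algebra_simps)
  also have "\<dots> = integral {0..(b - a) / (b - a)} (\<lambda>x. f (Complex (a + (b - a) * x) c))"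
    using \<open>a < b\<close> by (simp add: algebra_simps linepath_def)
  also have "{0..(b - a) / (b - a)} = (\<lambda>x. x / (b - a)) ` {0..b - a}"
    using \<open>a < b\<close> by simp
  also have "integral \<dots> (\<lambda>x. f (Complex (a + (b - a) * x) c)) =
             integral {a-a..b-a} (\<lambda>x. f (Complex (x + a) c)) / of_real (b - a)"
    using \<open>a < b\<close> by (subst integral_stretch_real) (auto simp: scaleR_conv_of_real add_ac)
  also have "\<dots> = integral {a..b} (\<lambda>x. f (Complex x c)) / of_real (b - a)"
    by (subst integral_shift_real_ivl) (rule refl)
  finally show ?thesis
    using \<open>a < b\<close> by simp
qed

lemma contour_integral_rectpath:
  assumes "a < b" "c < d"
    and cont: "continuous_on (path_image (rectpath (Complex a c) (Complex b d))) f"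
  shows "contour_integral (rectpath (Complex a c) (Complex b d)) f =
      integral {a..b} (\<lambda>x. f (Complex x c)) + \<i> * integral {c..d} (\<lambda>y. f (Complex b y))
    - integral {a..b} (\<lambda>x. f (Complex x d)) - \<i> * integral {c..d} (\<lambda>y. f (Complex a y))"
proof -
  let ?a1 = "Complex a c" and ?a2 = "Complex b c" and ?a3 = "Complex b d" and ?a4 = "Complex a d"
  have im: "path_image (rectpath ?a1 ?a3) = closed_segment ?a1 ?a2 \<union> closed_segment ?a2 ?a3 \<union>
              closed_segment ?a3 ?a4 \<union> closed_segment ?a4 ?a1"
    by (simp add: rectpath_def Let_def path_image_join Un_assoc)
  have int: "f contour_integrable_on linepath ?a1 ?a2" "f contour_integrable_on linepath ?a2 ?a3"
      "f contour_integrable_on linepath ?a3 ?a4" "f contour_integrable_on linepath ?a4 ?a1"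
    using cont by (auto intro!: contour_integrable_continuous_linepath elim: continuous_on_subset simp: im)
  have "contour_integral (rectpath ?a1 ?a3) f =
      contour_integral (linepath ?a1 ?a2) f + contour_integral (linepath ?a2 ?a3) f +
      contour_integral (linepath ?a3 ?a4) f + contour_integral (linepath ?a4 ?a1) f"
    using int by (simp add: rectpath_def Let_def add.assoc)
  also have "contour_integral (linepath ?a3 ?a4) f = - contour_integral (linepath ?a4 ?a3) f"
    using cont by (intro contour_integral_reverse_linepath) (auto elim: continuous_on_subset simp: im closed_segment_commute)
  also have "contour_integral (linepath ?a4 ?a1) f = - contour_integral (linepath ?a1 ?a4) f"
    using cont by (intro contour_integral_reverse_linepath) (auto elim: continuous_on_subset simp: im closed_segment_commute)
  finally show ?thesis
    using assms(1,2) by (simp add: contour_integral_linepath_horizontal contour_integral_linepath_same_Re)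
qed

text \<open>The difference quotient \<open>g w / (w - z)\<close> tends to \<open>g'\<close>, which
  is nonzero, so \<open>f w / g w * (w - z)\<close> has the limit \<open>f z / g'\<close>. If
  \<open>f z = 0\<close>, the singularity is removable and the formula correctly gives 0.\<close>

lemma residue_quotient_simple_zero:
  assumes "open s" "z \<in> s" "f holomorphic_on s" "g holomorphic_on s"
    and g0: "g z = 0" and nz: "\<And>w. w \<in> s - {z} \<Longrightarrow> g w \<noteq> 0"
    and g': "(g has_field_derivative g') (at z)" "g' \<noteq> 0"
  shows "residue (\<lambda>w. f w / g w) z = f z / g'"
proof (rule residue_simple'[OF assms(1,2)])
  show "(\<lambda>w. f w / g w) holomorphic_on s - {z}"
    using assms by (intro holomorphic_on_divide) (auto elim: holomorphic_on_subset)
  have "f \<midarrow>z\<rightarrow> f z"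
    using assms(1-3) by (metis continuous_on_eq_continuous_at holomorphic_on_imp_continuous_on isCont_def)
  moreover have "(\<lambda>w. g w / (w - z)) \<midarrow>z\<rightarrow> g'"
    using g' g0 by (simp add: has_field_derivative_iff)
  ultimately have "(\<lambda>w. f w / (g w / (w - z))) \<midarrow>z\<rightarrow> f z / g'"
    using g' by (intro tendsto_divide)
  thus "(\<lambda>w. f w / g w * (w - z)) \<midarrow>z\<rightarrow> f z / g'" by simp
qed

lemma exp_two_pi_i_eq_1_iff:
  assumes "(h::real) > 0"
  shows "exp (2 * pi * \<i> * z / h) = 1 \<longleftrightarrow> (\<exists>k::int. z = of_real (of_int k * h))"
proof -
  have "exp (2 * pi * \<i> * z / h) = 1 \<longleftrightarrow> Im z = 0 \<and> (\<exists>k::int. Re z = of_int k * h)"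
    using assms by (auto simp: exp_eq_1 field_simps Re_divide Im_divide power2_eq_square)
  thus ?thesis by (auto simp: complex_eq_iff)
qed

lemma open_strip: "open (strip d)" and convex_strip: "convex (strip d)"
proof -
  have eq: "strip d = {z. Im z < d} \<inter> {z. Im z > - d}" by (auto simp: strip_def)
  show "open (strip d)" unfolding eq by (intro open_Int open_halfspace_Im_lt open_halfspace_Im_gt)
  show "convex (strip d)" unfolding eq by (intro convex_Int convex_halfspace_Im_lt convex_halfspace_Im_gt)
qed

text \<open>At a node kh one has q = 1, and 1 - q has derivative -2 pi i / h, so the residue is -h
  F(kh) / (2 pi i). The half-integer multiple \<open>X\<close> of h keeps the vertical sides midway
  between nodes. Continuity on the path is recorded because splitting the integral into its four
  sides needs it.\<close>

lemma rectpath_trapezoidal_sum: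
  fixes F :: "complex \<Rightarrow> complex" and d h \<delta> :: real and m :: nat
  assumes holo: "F holomorphic_on strip d" and \<delta>: "0 < \<delta>" "\<delta> < d" and h: "0 < h"
    and X: "X = (real m + 1 / 2) * h"
  defines "q \<equiv> \<lambda>z. exp (2 * pi * \<i> * z / h)"
  shows "contour_integral (rectpath (Complex (-X) (-\<delta>)) (Complex X \<delta>)) (\<lambda>z. F z * q z / (1 - q z))
           = - (of_real h * (\<Sum>k=-int m..int m. F (of_real (of_int k * h))))" (is ?th1)
    and "continuous_on (path_image (rectpath (Complex (-X) (-\<delta>)) (Complex X \<delta>))) (\<lambda>z. F z * q z / (1 - q z))"
       (is ?th2)
proof -
  have Xpos: "X > 0" using X h by (auto intro: mult_pos_pos)
  \<comment> \<open>\<open>S\<close> is an open convex set around the closed rectangle. Its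
    half-width (m + 1)h exceeds \<open>X\<close> but does not reach the next node, so
    \<open>pts\<close> contains every zero of 1 - q in \<open>S\<close>.\<close>
  define S where "S = strip d \<inter> {z. \<bar>Re z\<bar> < (real m + 1) * h}"
  define pts where "pts = (\<lambda>k. complex_of_real (of_int k * h)) ` {-int m..int m}"
  have S': "S = strip d \<inter> ({z. Re z < (real m + 1) * h} \<inter> {z. Re z > - ((real m + 1) * h)})"
    by (auto simp: S_def)
  have opS: "open S" unfolding S'
    by (intro open_Int open_strip open_halfspace_Re_lt open_halfspace_Re_gt)
  have conv: "convex S" unfolding S'
    by (intro convex_Int convex_strip convex_halfspace_Re_lt convex_halfspace_Re_gt)
  have fin: "finite pts" by (simp add: pts_def)
  have holF: "F holomorphic_on S" using holo by (rule holomorphic_on_subset) (auto simp: S_def)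
  have holq: "q holomorphic_on A" for A unfolding q_def by (intro holomorphic_intros) (use h in auto)
  have q1: "q w \<noteq> 1" if "w \<in> S - pts" for w
  proof
    assume "q w = 1"
    then obtain k :: int where k: "w = of_real (of_int k * h)"
      using exp_two_pi_i_eq_1_iff[OF h] by (auto simp: q_def)
    have "\<bar>real_of_int k\<bar> * h < (real m + 1) * h" using that k h by (auto simp: S_def abs_mult)
    hence "\<bar>real_of_int k\<bar> < real m + 1" using h by simp
    hence "k \<in> {-int m..int m}" by auto
    hence "w \<in> pts" using k by (auto simp: pts_def)
    thus False using that by simp
  qed
  have hol: "(\<lambda>z. F z * q z / (1 - q z)) holomorphic_on S - pts"
    using q1 by (intro holomorphic_intros holq holomorphic_on_subset[OF holF]) auto
  let ?p = "rectpath (Complex (-X) (-\<delta>)) (Complex X \<delta>)"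
  have im_eq: "path_image ?p = cbox (Complex (-X) (-\<delta>)) (Complex X \<delta>) - box (Complex (-X) (-\<delta>)) (Complex X \<delta>)"
    using Xpos \<delta> by (intro path_image_rectpath_cbox_minus_box) auto
  have X_less: "X < (real m + 1) * h" using h X by (simp add: algebra_simps)
  have cbox_S: "cbox (Complex (-X) (-\<delta>)) (Complex X \<delta>) \<subseteq> S"
    using \<delta> X_less by (auto simp: S_def strip_def in_cbox_complex_iff)
  have pts_box: "pts \<subseteq> box (Complex (-X) (-\<delta>)) (Complex X \<delta>)"
  proof
    fix p assume "p \<in> pts"
    then obtain k where k: "p = of_real (of_int k * h)" "k \<in> {-int m..int m}" unfolding pts_def by blast
    have "\<bar>real_of_int k\<bar> < real m + 1 / 2" using k(2) by auto
    hence "\<bar>real_of_int k\<bar> * h < X" using h X by simp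
    hence "\<bar>real_of_int k * h\<bar> < X" using h by (simp add: abs_mult)
    thus "p \<in> box (Complex (-X) (-\<delta>)) (Complex X \<delta>)"
      using k \<delta> by (auto simp: in_box_complex_iff)
  qed
  have im: "path_image ?p \<subseteq> S - pts" using im_eq cbox_S pts_box by blast
  show ?th2 using hol im holomorphic_on_imp_continuous_on continuous_on_subset by blast
  have res: "residue (\<lambda>z. F z * q z / (1 - q z)) p = - (of_real h / (2 * pi * \<i>)) * F p" if p: "p \<in> pts" for p
  proof -
    have qp: "q p = 1" using p exp_two_pi_i_eq_1_iff[OF h] by (auto simp: q_def pts_def)
    have "residue (\<lambda>z. F z * q z / (1 - q z)) p = F p * q p / (- (2 * pi * \<i> / h))"
    proof (rule residue_quotient_simple_zero[where s = "S - (pts - {p})"])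
      show "open (S - (pts - {p}))" using opS fin by (simp add: open_Diff finite_imp_closed)
      show "p \<in> S - (pts - {p})" using p pts_box cbox_S box_subset_cbox by blast
      show "(\<lambda>w. F w * q w) holomorphic_on S - (pts - {p})"
        by (intro holomorphic_intros holq holomorphic_on_subset[OF holF]) auto
      show "(\<lambda>w. 1 - q w) holomorphic_on S - (pts - {p})" by (intro holomorphic_intros holq)
      show "1 - q p = 0" using qp by simp
      show "1 - q w \<noteq> 0" if "w \<in> S - (pts - {p}) - {p}" for w using q1[of w] that by auto
      have "((\<lambda>w. 1 - q w) has_field_derivative - (q p * (2 * pi * \<i> / h))) (at p)"
        unfolding q_def using h by (auto intro!: derivative_eq_intros)
      thus "((\<lambda>w. 1 - q w) has_field_derivative - (2 * pi * \<i> / h)) (at p)" using qp by simp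
      show "- (2 * pi * \<i> / h) \<noteq> 0" using h by simp
    qed
    thus ?thesis using qp h by (simp add: field_simps)
  qed
  have wind0: "\<forall>z. z \<notin> S \<longrightarrow> winding_number ?p z = 0"
    using cbox_S Xpos \<delta> by (auto intro!: winding_number_rectpath_outside)
  have "contour_integral ?p (\<lambda>z. F z * q z / (1 - q z)) =
     2 * pi * \<i> * (\<Sum>p\<in>pts. winding_number ?p p * residue (\<lambda>z. F z * q z / (1 - q z)) p)"
    by (rule Residue_theorem[OF opS convex_connected[OF conv] fin hol _ _ im wind0]) auto
  also have "(\<Sum>p\<in>pts. winding_number ?p p * residue (\<lambda>z. F z * q z / (1 - q z)) p) =
      (\<Sum>p\<in>pts. - (of_real h / (2 * pi * \<i>)) * F p)"
    using pts_box res by (intro sum.cong refl) (auto simp: winding_number_rectpath subset_iff)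
  also have "\<dots> = - (of_real h / (2 * pi * \<i>)) * (\<Sum>p\<in>pts. F p)" by (simp only: sum_distrib_left)
  also have "(\<Sum>p\<in>pts. F p) = (\<Sum>k=-int m..int m. F (of_real (of_int k * h)))"
    unfolding pts_def using h by (subst sum.reindex) (auto simp: inj_on_def o_def)
  finally show ?th1 by simp
qed

lemma norm_div_one_minus_le:
  assumes "norm (p :: complex) \<le> \<rho>" "\<rho> < 1"
  shows "norm (p / (1 - p)) \<le> \<rho> / (1 - \<rho>)"
proof -
  have "1 - norm p \<le> norm (1 - p)" using norm_triangle_ineq2[of 1 p] by simp
  thus ?thesis using assms unfolding norm_divide
    by (intro frac_le) (auto intro: order_trans[OF norm_ge_zero])
qed

text \<open>The rectangle stops at height \<delta> < d because F is only given on the open strip.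
  Each horizontal edge contributes \<open>\<rho> / (1 - \<rho>) * J\<close>. The last term collects
  the vertical sides: each of the two lines Re z = X and Re z = -X counts with length \<delta> when
  the lower edge is moved to the real axis and with length 2\<delta> in the contour around the
  nodes.\<close>

lemma trapezoidal_rectangle_error:
  fixes F :: "complex \<Rightarrow> complex" and G :: "real \<Rightarrow> real" and d h \<delta> :: real and m :: nat
  assumes holo: "F holomorphic_on strip d" and \<delta>: "0 < \<delta>" "\<delta> < d" and h: "0 < h"
    and X: "X = (real m + 1 / 2) * h"
    and bound: "\<And>z. z \<in> strip d \<Longrightarrow> norm (F z) \<le> G (Re z)"
    and G: "G integrable_on {-X..X}" "integral {-X..X} G \<le> J"
  defines "\<rho> \<equiv> exp (- (2 * pi * \<delta> / h))"
  shows "norm (integral {-X..X} (\<lambda>x. F (of_real x))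
            - of_real h * (\<Sum>k=-int m..int m. F (of_real (of_int k * h))))
         \<le> 2 * (\<rho> / (1 - \<rho>) * J) + 3 * \<delta> * (G X + G (-X))"
proof -
  have Xpos: "X > 0" using X h by (auto intro: mult_pos_pos)
  define q where "q = (\<lambda>z. exp (2 * pi * \<i> * z / h))"
  \<comment> \<open>\<open>p\<close> is 1/q. It is the small quantity on the lower edge, where |q| =
    1/\<rho> > 1.\<close>
  define p where "p = (\<lambda>z. exp (- (2 * pi * \<i> * z / h)))"
  define \<phi> where "\<phi> = (\<lambda>z. F z * q z / (1 - q z))"
  have pq: "p z = 1 / q z" "q z \<noteq> 0" for z
    by (simp_all add: p_def q_def exp_minus field_simps)
  have nq: "norm (q z) = exp (- (2 * pi * Im z / h))" for z
    using h by (simp add: q_def Re_divide Im_divide power2_eq_square)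
  have np: "norm (p z) = exp (2 * pi * Im z / h)" for z
    using h by (simp add: p_def Re_divide Im_divide power2_eq_square)
  have \<rho>: "0 < \<rho>" "\<rho> < 1" using \<delta> h by (auto simp: \<rho>_def)
  have contF: "continuous_on (strip d) F" using holo by (rule holomorphic_on_imp_continuous_on)
  have contq: "continuous_on A q" "continuous_on A p" for A
    unfolding q_def p_def using h by (auto intro!: continuous_intros)
  have strip_re: "Complex x y \<in> strip d" if "y \<in> {-\<delta>..\<delta>}" for x y
    using that \<delta> by (auto simp: strip_def)
  \<comment> \<open>The multiplier \<open>k\<close> stands for q/(1 - q) on the upper edge and for
    p/(1 - p) on the lower one. In \<open>vert\<close> it is q/(1 - q), or 1 for the sides that
    carry F alone.\<close>
  have horiz: "norm (integral {-X..X} (\<lambda>x. F (Complex x y) * k (Complex x y))) \<le> \<rho> / (1 - \<rho>) * J"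
    if y: "y \<in> {-\<delta>..\<delta>}" and k: "continuous_on (range (\<lambda>x. Complex x y)) k"
       "\<And>x. norm (k (Complex x y)) \<le> \<rho> / (1 - \<rho>)"
    for y and k :: "complex \<Rightarrow> complex"
  proof -
    have "norm (integral {-X..X} (\<lambda>x. F (Complex x y) * k (Complex x y)))
            \<le> integral {-X..X} (\<lambda>x. \<rho> / (1 - \<rho>) * G x)"
    proof (rule integral_norm_bound_integral)
      show "(\<lambda>x. F (Complex x y) * k (Complex x y)) integrable_on {-X..X}"
        using y strip_re
        by (intro integrable_continuous_real continuous_intros continuous_on_compose2[OF contF]
              continuous_on_compose2[OF k(1)]) (auto simp: Complex_eq intro!: continuous_intros)
      show "(\<lambda>x. \<rho> / (1 - \<rho>) * G x) integrable_on {-X..X}" using G by (intro integrable_on_mult_right)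
      show "norm (F (Complex x y) * k (Complex x y)) \<le> \<rho> / (1 - \<rho>) * G x" if "x \<in> {-X..X}" for x
        using mult_mono[OF k(2)[of x] bound[OF strip_re[OF y]]] \<rho> by (simp add: norm_mult mult.commute)
    qed
    also have "\<dots> = \<rho> / (1 - \<rho>) * integral {-X..X} G" by simp
    also have "\<dots> \<le> \<rho> / (1 - \<rho>) * J" using G \<rho> by (intro mult_left_mono) auto
    finally show ?thesis .
  qed
  have vert: "norm (integral {a..b} (\<lambda>y. F (Complex x y) * k (Complex x y))) \<le> (b - a) * G x"
    if ab: "a \<le> b" "{a..b} \<subseteq> {-\<delta>..\<delta>}" and k: "continuous_on (range (\<lambda>y. Complex x y)) k"
       "\<And>y. norm (k (Complex x y)) \<le> 1"
    for a b x and k :: "complex \<Rightarrow> complex"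
  proof -
    have "norm (integral {a..b} (\<lambda>y. F (Complex x y) * k (Complex x y))) \<le> G x * (b - a)"
    proof (rule integral_bound[OF ab(1)])
      show "continuous_on {a..b} (\<lambda>y. F (Complex x y) * k (Complex x y))"
        using ab strip_re
        by (intro continuous_intros continuous_on_compose2[OF contF]
              continuous_on_compose2[OF k(1)]) (auto simp: Complex_eq intro!: continuous_intros)
      show "norm (F (Complex x y) * k (Complex x y)) \<le> G x" if "y \<in> {a..b}" for y
      proof -
        from that have "y \<in> {-\<delta>..\<delta>}" using ab by auto
        hence "norm (F (Complex x y)) \<le> G x" using bound[OF strip_re[of y x]] by simp
        thus "norm (F (Complex x y) * k (Complex x y)) \<le> G x"
          using mult_mono[OF _ k(2)[of y], of "norm (F (Complex x y))" "G x"]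
          by (simp add: norm_mult order_trans[OF norm_ge_zero])
      qed
    qed
    thus ?thesis by (simp add: mult.commute)
  qed
  let ?I = "\<lambda>f y. integral {-X..X} (\<lambda>x. f (Complex x y))"
  let ?V = "\<lambda>f a b x. integral {a..b} (\<lambda>y. f (Complex x y))"
  \<comment> \<open>Cauchy's theorem on the lower half of the rectangle moves the integral of F from
    the lower edge to the real axis, at the price of two vertical sides of length \<delta>.\<close>
  have im1: "path_image (rectpath (Complex (-X) (-\<delta>)) (Complex X 0)) \<subseteq> strip d"
    using Xpos \<delta> by (subst path_image_rectpath) (auto simp: strip_def)
  have "contour_integral (rectpath (Complex (-X) (-\<delta>)) (Complex X 0)) F = 0"
    by (rule contour_integral_unique, rule Cauchy_theorem_convex_simple[OF holo convex_strip _ im1]) auto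
  moreover have "contour_integral (rectpath (Complex (-X) (-\<delta>)) (Complex X 0)) F =
    ?I F (-\<delta>) + \<i> * ?V F (-\<delta>) 0 X - ?I F 0 - \<i> * ?V F (-\<delta>) 0 (-X)"
    using Xpos \<delta> continuous_on_subset[OF contF im1] by (intro contour_integral_rectpath) auto
  ultimately have C1: "?I F (-\<delta>) = ?I F 0 - \<i> * ?V F (-\<delta>) 0 X + \<i> * ?V F (-\<delta>) 0 (-X)"
    by (simp add: algebra_simps)
  note T = rectpath_trapezoidal_sum[OF holo \<delta> h X, folded \<phi>_def[unfolded q_def]]
  have C2: "- (of_real h * (\<Sum>k=-int m..int m. F (of_real (of_int k * h)))) =
    ?I \<phi> (-\<delta>) + \<i> * ?V \<phi> (-\<delta>) \<delta> X - ?I \<phi> \<delta> - \<i> * ?V \<phi> (-\<delta>) \<delta> (-X)"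
    unfolding T(1)[symmetric] using Xpos \<delta> T(2) by (intro contour_integral_rectpath) auto
  have p_ne: "p (Complex x (-\<delta>)) \<noteq> 1" for x
    using np[of "Complex x (-\<delta>)"] \<rho> by (auto simp: \<rho>_def)
  have q_ne: "q (Complex x \<delta>) \<noteq> 1" for x
    using nq[of "Complex x \<delta>"] \<rho> by (auto simp: \<rho>_def)
  \<comment> \<open>This is the identity q/(1 - q) = -1 - p/(1 - p): on the lower edge \<phi> equals
    -F up to a small error.\<close>
  have "\<phi> (Complex x (-\<delta>)) = - F (Complex x (-\<delta>))
     - F (Complex x (-\<delta>)) * (p (Complex x (-\<delta>)) / (1 - p (Complex x (-\<delta>))))" for x
  proof -
    have alg: "a * Q / (1 - Q) = - a - a * (P / (1 - P))" if "Q \<noteq> 0" "P = 1 / Q" "P \<noteq> 1" for a P Q :: complex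
    proof -
      have "1 - Q \<noteq> 0" "Q - 1 \<noteq> 0" using that by auto
      hence "a * Q / (1 - Q) = - a - a * (1 / (Q - 1))"
        by (simp add: divide_simps) (simp add: algebra_simps)
      moreover have "P / (1 - P) = 1 / (Q - 1)" using that by (auto simp: divide_simps) (auto simp: algebra_simps)
      ultimately show ?thesis by simp
    qed
    show ?thesis unfolding \<phi>_def by (rule alg) (use p_ne[of x] pq in auto)
  qed
  hence "?I \<phi> (-\<delta>) = integral {-X..X} (\<lambda>x. - F (Complex x (-\<delta>))
     - F (Complex x (-\<delta>)) * (p (Complex x (-\<delta>)) / (1 - p (Complex x (-\<delta>)))))" by simp
  also have "\<dots> = - ?I F (-\<delta>) - integral {-X..X} (\<lambda>x. F (Complex x (-\<delta>)) * (p (Complex x (-\<delta>)) / (1 - p (Complex x (-\<delta>)))))"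
    using p_ne \<delta> strip_re
    by (subst integral_diff)
       (auto intro!: integrable_continuous_real continuous_intros continuous_on_compose2[OF contF]
              continuous_on_compose2[OF contq(2)[of UNIV]] simp: Complex_eq strip_def)
  finally have C3: "?I \<phi> (-\<delta>) = - ?I F (-\<delta>) - integral {-X..X} (\<lambda>x. F (Complex x (-\<delta>)) * (p (Complex x (-\<delta>)) / (1 - p (Complex x (-\<delta>)))))" .
  define P where "P = integral {-X..X} (\<lambda>x. F (Complex x (-\<delta>)) * (\<lambda>z. p z / (1 - p z)) (Complex x (-\<delta>)))"
  have P: "norm P \<le> \<rho> / (1 - \<rho>) * J" unfolding P_def
  proof (rule horiz[where y = "-\<delta>" and k = "\<lambda>z. p z / (1 - p z)"])
    show "continuous_on (range (\<lambda>x. Complex x (-\<delta>))) (\<lambda>z. p z / (1 - p z))"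
      using p_ne by (intro continuous_intros contq) auto
    show "norm (p (Complex x (-\<delta>)) / (1 - p (Complex x (-\<delta>)))) \<le> \<rho> / (1 - \<rho>)" for x
      using \<rho> by (intro norm_div_one_minus_le) (auto simp: np \<rho>_def)
  qed (use \<delta> in auto)
  have "norm (integral {-X..X} (\<lambda>x. F (Complex x \<delta>) * (\<lambda>z. q z / (1 - q z)) (Complex x \<delta>))) \<le> \<rho> / (1 - \<rho>) * J"
  proof (rule horiz[where y = \<delta> and k = "\<lambda>z. q z / (1 - q z)"])
    show "continuous_on (range (\<lambda>x. Complex x \<delta>)) (\<lambda>z. q z / (1 - q z))"
      using q_ne by (intro continuous_intros contq) auto
    show "norm (q (Complex x \<delta>) / (1 - q (Complex x \<delta>))) \<le> \<rho> / (1 - \<rho>)" for x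
      using \<rho> by (intro norm_div_one_minus_le) (auto simp: nq \<rho>_def)
  qed (use \<delta> in auto)
  hence Q: "norm (?I \<phi> \<delta>) \<le> \<rho> / (1 - \<rho>) * J" by (simp add: \<phi>_def)
  \<comment> \<open>X/h is a half-integer, so q is a negative real -r on the vertical sides. Hence
    |q/(1 - q)| = r/(1 + r) < 1, uniformly in the height and in m.\<close>
  have q_side: "q (Complex (c * X) y) = - of_real (exp (- (2 * pi * y / h)))" if "c = 1 \<or> c = -1" for c y
  proof -
    have "2 * pi * \<i> * Complex (c * X) y / h = of_real (- (2 * pi * y / h)) + \<i> * of_real (2 * pi * (c * X / h))"
      using h by (simp add: complex_eq_iff Re_divide Im_divide power2_eq_square)
    moreover have "c * X / h = c * (real m + 1 / 2)" using h X by simp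
    ultimately have "q (Complex (c * X) y) = of_real (exp (- (2 * pi * y / h))) * cis (2 * pi * (c * (real m + 1 / 2)))"
      unfolding q_def by (simp only: exp_add exp_of_real cis_conv_exp)
    also have "cis (2 * pi * (c * (real m + 1 / 2))) = cis (2 * pi * of_int (if c = 1 then int m else - int m)) * cis (c * pi)"
      using that by (auto simp: cis_mult algebra_simps)
    also have "\<dots> = -1" using that by (subst cis_multiple_2pi) (auto simp: complex_eq_iff)
    finally show ?thesis by simp
  qed
  have Vq: "norm (integral {-\<delta>..\<delta>} (\<lambda>y. F (Complex (c * X) y) * (\<lambda>z. q z / (1 - q z)) (Complex (c * X) y))) \<le> (\<delta> - -\<delta>) * G (c * X)"
    if c: "c = 1 \<or> c = -1" for c
  proof (rule vert[where k = "\<lambda>z. q z / (1 - q z)"])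
    have ne: "q (Complex (c * X) y) \<noteq> 1" for y
      by (subst q_side[OF c]) (auto simp: complex_eq_iff, smt (verit) exp_gt_zero)
    show "continuous_on (range (Complex (c * X))) (\<lambda>z. q z / (1 - q z))"
      using ne by (intro continuous_intros contq) auto
    show "norm (q (Complex (c * X) y) / (1 - q (Complex (c * X) y))) \<le> 1" for y
    proof -
      let ?r = "exp (- (2 * pi * y / h))"
      have "q (Complex (c * X) y) / (1 - q (Complex (c * X) y)) = of_real (- ?r / (1 + ?r))"
        by (subst (1 2) q_side[OF c]) simp
      also have "norm \<dots> \<le> 1" unfolding norm_of_real by (simp add: abs_divide add_pos_pos)
      finally show ?thesis .
    qed
  qed (use \<delta> in auto)
  have V1: "norm (?V F (-\<delta>) 0 x) \<le> \<delta> * G x" for x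
    using vert[of "-\<delta>" 0 x "\<lambda>_. 1"] \<delta> by auto
  have V2: "norm (?V \<phi> (-\<delta>) \<delta> X) \<le> 2 * \<delta> * G X" "norm (?V \<phi> (-\<delta>) \<delta> (-X)) \<le> 2 * \<delta> * G (-X)"
    using Vq[of 1] Vq[of "-1"] by (simp_all add: \<phi>_def)
  have I0: "?I F 0 = integral {-X..X} (\<lambda>x. F (of_real x))" by (simp add: complex_of_real_def)
  \<comment> \<open>Eliminating both lower-edge integrals from \<open>C1\<close>, \<open>C2\<close>
    and \<open>C3\<close> leaves only error terms.\<close>
  have "norm (integral {-X..X} (\<lambda>x. F (of_real x)) - of_real h * (\<Sum>k=-int m..int m. F (of_real (of_int k * h))))
     = norm ( \<i> * ?V F (-\<delta>) 0 X - \<i> * ?V F (-\<delta>) 0 (-X) - P - ?I \<phi> \<delta> + \<i> * ?V \<phi> (-\<delta>) \<delta> X - \<i> * ?V \<phi> (-\<delta>) \<delta> (-X))"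
  proof -
    have alg: "I - H = a - b - P - t + c - e"
      if "Ib = I - a + b" "- H = pb + c - t - e" "pb = - Ib - P" for I Ib H a b c e t P pb :: complex
    proof -
      have "I - H = I + (- H)" by simp
      also have "- H = - (I - a + b) - P + c - t - e" using that by metis
      finally show ?thesis by (simp add: algebra_simps)
    qed
    show ?thesis unfolding I0[symmetric] P_def by (rule arg_cong[where f = norm], rule alg[OF C1 C2 C3])
  qed
  also have "\<dots> \<le> norm (?V F (-\<delta>) 0 X) + norm (?V F (-\<delta>) 0 (-X)) + norm P + norm (?I \<phi> \<delta>)
     + norm (?V \<phi> (-\<delta>) \<delta> X) + norm (?V \<phi> (-\<delta>) \<delta> (-X))"
  proof -
    have tri: "norm (\<i> * a - \<i> * b - P - t + \<i> * c - \<i> * e) \<le> norm a + norm b + norm P + norm t + norm c + norm e"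
      for a b c e t P :: complex
    proof -
      have "norm (a - b - P - t + c - e) \<le> norm a + norm b + norm P + norm t + norm c + norm e"
        for a b c e t P :: complex
        using norm_triangle_ineq4[of "a - b - P - t + c" e] norm_triangle_ineq[of "a - b - P - t" c]
          norm_triangle_ineq4[of "a - b - P" t] norm_triangle_ineq4[of "a - b" P]
          norm_triangle_ineq4[of a b] by linarith
      from this[of "\<i> * a" "\<i> * b" P t "\<i> * c" "\<i> * e"] show ?thesis by (simp add: norm_mult)
    qed
    show ?thesis by (rule tri)
  qed
  also have "\<dots> \<le> \<delta> * G X + \<delta> * G (-X) + \<rho> / (1 - \<rho>) * J + \<rho> / (1 - \<rho>) * J + 2 * \<delta> * G X + 2 * \<delta> * G (-X)"
    using V1[of X] V1[of "-X"] V2 P Q by linarith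
  finally show ?thesis by (simp add: algebra_simps)
qed

subsection \<open>Truncation and passage to the limit\<close>

text \<open>A common majorant for both transformations. It is a pure exponential on each half-line,
  so its integral and the tails of its trapezoidal sums are elementary.\<close>

definition decay :: "real \<Rightarrow> real \<Rightarrow> real \<Rightarrow> real" where
  "decay \<alpha> \<beta> x = (if x \<le> 0 then exp (\<alpha> * x) else exp (- \<beta> * x))"

lemma integral_decay:
  assumes "0 < \<alpha>" "0 < \<beta>" "0 \<le> X"
  shows "decay \<alpha> \<beta> integrable_on {-X..X}" "integral {-X..X} (decay \<alpha> \<beta>) \<le> 1 / \<alpha> + 1 / \<beta>"
proof -
  have "((\<lambda>x. exp (\<alpha> * x)) has_integral (exp (\<alpha> * 0) / \<alpha> - exp (\<alpha> * (-X)) / \<alpha>)) {-X..0}"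
    using assms by (intro fundamental_theorem_of_calculus)
      (auto intro!: derivative_eq_intros simp flip: has_real_derivative_iff_has_vector_derivative)
  hence 1: "(decay \<alpha> \<beta> has_integral (1 / \<alpha> - exp (- \<alpha> * X) / \<alpha>)) {-X..0}"
    by (rule has_integral_eq[rotated, THEN has_integral_eq_rhs]) (auto simp: decay_def)
  have "((\<lambda>x. exp (- \<beta> * x)) has_integral (- exp (- \<beta> * X) / \<beta> - - exp (- \<beta> * 0) / \<beta>)) {0..X}"
    using assms by (intro fundamental_theorem_of_calculus)
      (auto intro!: derivative_eq_intros simp flip: has_real_derivative_iff_has_vector_derivative)
  hence 2: "(decay \<alpha> \<beta> has_integral (1 / \<beta> - exp (- \<beta> * X) / \<beta>)) {0..X}"
    by (rule has_integral_eq[rotated, THEN has_integral_eq_rhs]) (auto simp: decay_def)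
  have 3: "(decay \<alpha> \<beta> has_integral ((1 / \<alpha> - exp (- \<alpha> * X) / \<alpha>) + (1 / \<beta> - exp (- \<beta> * X) / \<beta>))) {-X..X}"
    using has_integral_combine[OF _ _ 1 2] assms by simp
  thus "decay \<alpha> \<beta> integrable_on {-X..X}" by blast
  show "integral {-X..X} (decay \<alpha> \<beta>) \<le> 1 / \<alpha> + 1 / \<beta>"
    unfolding integral_unique[OF 3]
    using divide_pos_pos[OF exp_gt_zero assms(1), of "- \<alpha> * X"]
      divide_pos_pos[OF exp_gt_zero assms(2), of "- \<beta> * X"] by linarith
qed

text \<open>The sum telescopes: 1 + bh \<le> exp(bh) bounds h exp(-b(k+1)h) by (exp(-bkh) -
  exp(-b(k+1)h))/b. This compares the sum with the integral of a decreasing function, so no factor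
  depending on h is lost. The induction carries the full difference, and its negative part is
  dropped at the end.\<close>

lemma exp_tail_sum_le:
  fixes b h :: real and N m :: int
  assumes "0 < b" "0 < h" "N \<le> m"
  shows "h * (\<Sum>k=N+1..m. exp (- b * (of_int k * h))) \<le> exp (- b * (of_int N * h)) / b"
proof -
  have "h * (\<Sum>k=N+1..m. exp (- b * (of_int k * h))) \<le> (exp (- b * (of_int N * h)) - exp (- b * (of_int m * h))) / b"
    using assms(3)
  proof (induction m rule: int_ge_induct)
    case base thus ?case by simp
  next
    case (step m)
    let ?e = "\<lambda>k::int. exp (- b * (of_int k * h))"
    have "{N+1..m+1} = insert (m+1) {N+1..m}" using step by auto
    hence "h * (\<Sum>k=N+1..m+1. ?e k) = h * (\<Sum>k=N+1..m. ?e k) + h * ?e (m+1)"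
      by (simp add: algebra_simps)
    also have "h * ?e (m+1) \<le> (?e m - ?e (m+1)) / b"
    proof -
      have "?e m = ?e (m+1) * exp (b * h)" by (simp add: algebra_simps flip: exp_add)
      moreover have "?e (m+1) * (1 + b * h) \<le> ?e (m+1) * exp (b * h)"
        by (intro mult_left_mono) auto
      ultimately show ?thesis using assms(1) by (simp add: field_simps)
    qed
    finally show ?case using step.IH assms(1) by (simp add: diff_divide_distrib)
  qed
  also have "\<dots> \<le> exp (- b * (of_int N * h)) / b" using assms(1) by (simp add: field_simps)
  finally show ?thesis .
qed

text \<open>The omitted nodes are those with k < -M and those with k > N. Reflecting the first block
  by k -> -k turns both into tails covered by \<open>exp_tail_sum_le\<close>. The bound does not
  depend on m, which later tends to infinity.\<close>

lemma truncation_error: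
  fixes F :: "real \<Rightarrow> complex" and M N :: int and m :: nat
  assumes pos: "0 < \<alpha>" "0 < \<beta>" "0 < h" "0 \<le> B" and MN: "0 \<le> M" "0 \<le> N" "M \<le> int m" "N \<le> int m"
    and bound: "\<And>x. norm (F x) \<le> B * decay \<alpha> \<beta> x"
  shows "norm (of_real h * (\<Sum>k=-int m..int m. F (of_int k * h)) - of_real h * (\<Sum>k=-M..N. F (of_int k * h)))
          \<le> B * (exp (- \<alpha> * (of_int M * h)) / \<alpha> + exp (- \<beta> * (of_int N * h)) / \<beta>)"
proof -
  let ?t = "\<lambda>k::int. F (of_int k * h)"
  have "sum ?t {-int m..int m} = sum ?t ({-int m..-M-1} \<union> ({-M..N} \<union> {N+1..int m}))"
    using MN by (intro sum.cong) auto
  also have "\<dots> = sum ?t {-int m..-M-1} + sum ?t ({-M..N} \<union> {N+1..int m})"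
    using MN by (intro sum.union_disjoint) auto
  also have "sum ?t ({-M..N} \<union> {N+1..int m}) = sum ?t {-M..N} + sum ?t {N+1..int m}"
    by (intro sum.union_disjoint) auto
  finally have "norm (of_real h * sum ?t {-int m..int m} - of_real h * sum ?t {-M..N})
     = norm (of_real h * sum ?t {-int m..-M-1} + of_real h * sum ?t {N+1..int m})"
    by (simp add: algebra_simps)
  also have "\<dots> \<le> h * norm (sum ?t {-int m..-M-1}) + h * norm (sum ?t {N+1..int m})"
    using pos by (intro order_trans[OF norm_triangle_ineq]) (simp add: norm_mult)
  also have "\<dots> \<le> B * (exp (- \<alpha> * (of_int M * h)) / \<alpha>) + B * (exp (- \<beta> * (of_int N * h)) / \<beta>)"
  proof (rule add_mono)
    have "norm (sum ?t {-int m..-M-1}) \<le> (\<Sum>k=-int m..-M-1. B * exp (- \<alpha> * (of_int (-k) * h)))"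
    proof (intro sum_norm_le)
      fix k assume "k \<in> {-int m..-M-1}"
      hence "of_int k * h \<le> 0" using MN pos by (auto intro!: mult_nonpos_nonneg)
      thus "norm (?t k) \<le> B * exp (- \<alpha> * (of_int (-k) * h))" using bound[of "of_int k * h"] by (simp add: decay_def)
    qed
    also have "\<dots> = (\<Sum>k=M+1..int m. B * exp (- \<alpha> * (of_int k * h)))"
      by (rule sum.reindex_bij_witness[of _ uminus uminus]) auto
    finally have "h * norm (sum ?t {-int m..-M-1}) \<le> B * (h * (\<Sum>k=M+1..int m. exp (- \<alpha> * (of_int k * h))))"
      using pos by (simp add: sum_distrib_left[symmetric] mult.left_commute)
    also have "\<dots> \<le> B * (exp (- \<alpha> * (of_int M * h)) / \<alpha>)"
      using pos MN by (intro mult_left_mono exp_tail_sum_le) auto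
    finally show "h * norm (sum ?t {-int m..-M-1}) \<le> B * (exp (- \<alpha> * (of_int M * h)) / \<alpha>)" .
    have "norm (sum ?t {N+1..int m}) \<le> (\<Sum>k=N+1..int m. B * exp (- \<beta> * (of_int k * h)))"
    proof (intro sum_norm_le)
      fix k assume "k \<in> {N+1..int m}"
      hence "of_int k * h > 0" using MN pos by auto
      thus "norm (?t k) \<le> B * exp (- \<beta> * (of_int k * h))" using bound[of "of_int k * h"] by (simp add: decay_def)
    qed
    hence "h * norm (sum ?t {N+1..int m}) \<le> B * (h * (\<Sum>k=N+1..int m. exp (- \<beta> * (of_int k * h))))"
      using pos by (simp add: sum_distrib_left[symmetric] mult.left_commute)
    also have "\<dots> \<le> B * (exp (- \<beta> * (of_int N * h)) / \<beta>)"
      using pos MN by (intro mult_left_mono exp_tail_sum_le) auto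
    finally show "h * norm (sum ?t {N+1..int m}) \<le> B * (exp (- \<beta> * (of_int N * h)) / \<beta>)" .
  qed
  finally show ?thesis by (simp add: algebra_simps)
qed

lemma filterlim_half_integers:
  assumes "0 < (h::real)"
  shows "filterlim (\<lambda>m. (real m + 1 / 2) * h) at_top sequentially"
proof -
  have "filterlim (\<lambda>m. h * (1 / 2 + real m)) at_top sequentially"
    using assms by (intro filterlim_tendsto_pos_mult_at_top[OF tendsto_const]
       filterlim_tendsto_add_at_top[OF tendsto_const] filterlim_real_sequentially) auto
  thus ?thesis by (simp add: mult.commute add.commute)
qed

lemma decay_tendsto_0:
  assumes "0 < \<alpha>" "0 < \<beta>" "0 < (h::real)"
  shows "(\<lambda>m. decay \<alpha> \<beta> ((real m + 1 / 2) * h)) \<longlonglongrightarrow> 0"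
    and "(\<lambda>m. decay \<alpha> \<beta> (- ((real m + 1 / 2) * h))) \<longlonglongrightarrow> 0"
proof -
  have lim: "(\<lambda>m. exp (- b * ((real m + 1 / 2) * h))) \<longlonglongrightarrow> 0" if "b > 0" for b
  proof (rule filterlim_compose[OF exp_at_bot])
    have "filterlim (\<lambda>m. b * ((real m + 1 / 2) * h)) at_top sequentially"
      using that by (intro filterlim_tendsto_pos_mult_at_top[OF tendsto_const] filterlim_half_integers assms)
    thus "filterlim (\<lambda>m. - b * ((real m + 1 / 2) * h)) at_bot sequentially"
      by (simp add: filterlim_uminus_at_bot)
  qed
  have "decay \<alpha> \<beta> ((real m + 1 / 2) * h) = exp (- \<beta> * ((real m + 1 / 2) * h))"
       "decay \<alpha> \<beta> (- ((real m + 1 / 2) * h)) = exp (- \<alpha> * ((real m + 1 / 2) * h))" for m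
    using mult_pos_pos[of "real m + 1/2" h] assms by (simp_all add: decay_def not_le[symmetric])
  thus "(\<lambda>m. decay \<alpha> \<beta> ((real m + 1 / 2) * h)) \<longlonglongrightarrow> 0"
    and "(\<lambda>m. decay \<alpha> \<beta> (- ((real m + 1 / 2) * h))) \<longlonglongrightarrow> 0" using lim assms by simp_all
qed

text \<open>Two limits are taken in turn. First m tends to infinity with \<delta> fixed, which
  removes the vertical sides; then \<delta> tends to d from below. The constants \<open>A\<close>
  for the strip and \<open>B\<close> for the real axis stay separate, since discretization sees the
  edges of the strip while truncation sees only real nodes.\<close>

lemma sinc_quadrature_error:
  fixes F :: "complex \<Rightarrow> complex" and M N :: int
  assumes holo: "F holomorphic_on strip d"
    and pos: "0 < d" "0 < h" "0 < \<alpha>" "0 < \<beta>" "0 \<le> A" "0 \<le> B" "0 \<le> M" "0 \<le> N"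
    and bound: "\<And>z. z \<in> strip d \<Longrightarrow> norm (F z) \<le> A * decay \<alpha> \<beta> (Re z)"
    and bound_real: "\<And>x. norm (F (of_real x)) \<le> B * decay \<alpha> \<beta> x"
    and lim: "(\<lambda>m. integral {- ((real m + 1 / 2) * h)..(real m + 1 / 2) * h} (\<lambda>x. F (of_real x))) \<longlonglongrightarrow> I"
  defines "\<rho> \<equiv> exp (- (2 * pi * d / h))"
  shows "norm (I - of_real h * (\<Sum>k=-M..N. F (of_real (of_int k * h))))
     \<le> 2 * (\<rho> / (1 - \<rho>) * (A * (1 / \<alpha> + 1 / \<beta>)))
        + B * (exp (- \<alpha> * (of_int M * h)) / \<alpha> + exp (- \<beta> * (of_int N * h)) / \<beta>)"
proof -
  let ?X = "\<lambda>m. (real m + 1 / 2) * h"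
  let ?J = "A * (1 / \<alpha> + 1 / \<beta>)"
  let ?T = "B * (exp (- \<alpha> * (of_int M * h)) / \<alpha> + exp (- \<beta> * (of_int N * h)) / \<beta>)"
  let ?S = "of_real h * (\<Sum>k=-M..N. F (of_real (of_int k * h)))"
  let ?r = "\<lambda>\<delta>. exp (- (2 * pi * \<delta> / h))"
  have fin: "norm (I - ?S) \<le> 2 * (?r \<delta> / (1 - ?r \<delta>) * ?J) + ?T" if \<delta>: "0 < \<delta>" "\<delta> < d" for \<delta>
  proof (rule LIMSEQ_le)
    show "(\<lambda>m. norm (integral {- ?X m..?X m} (\<lambda>x. F (of_real x)) - ?S)) \<longlonglongrightarrow> norm (I - ?S)"
      by (intro tendsto_intros lim)
    have "(\<lambda>m. 2 * (?r \<delta> / (1 - ?r \<delta>) * ?J) + 3 * \<delta> * (A * decay \<alpha> \<beta> (?X m) + A * decay \<alpha> \<beta> (- ?X m)) + ?T)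
      \<longlonglongrightarrow> 2 * (?r \<delta> / (1 - ?r \<delta>) * ?J) + 3 * \<delta> * (A * 0 + A * 0) + ?T"
      by (intro tendsto_intros decay_tendsto_0 pos)
    thus "(\<lambda>m. 2 * (?r \<delta> / (1 - ?r \<delta>) * ?J) + 3 * \<delta> * (A * decay \<alpha> \<beta> (?X m) + A * decay \<alpha> \<beta> (- ?X m)) + ?T)
      \<longlonglongrightarrow> 2 * (?r \<delta> / (1 - ?r \<delta>) * ?J) + ?T" by simp
    show "\<exists>m0. \<forall>m\<ge>m0. norm (integral {- ?X m..?X m} (\<lambda>x. F (of_real x)) - ?S) \<le>
        2 * (?r \<delta> / (1 - ?r \<delta>) * ?J) + 3 * \<delta> * (A * decay \<alpha> \<beta> (?X m) + A * decay \<alpha> \<beta> (- ?X m)) + ?T"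
    proof (intro exI allI impI)
      \<comment> \<open>From this m on, the truncated sum is a part of the sum over the nodes inside
        the rectangle.\<close>
      fix m assume "m \<ge> nat (max M N)"
      hence m: "M \<le> int m" "N \<le> int m" by auto
      let ?Sm = "of_real h * (\<Sum>k=-int m..int m. F (of_real (of_int k * h)))"
      have X0: "0 \<le> ?X m" using pos by simp
      have J: "integral {- ?X m..?X m} (\<lambda>x. A * decay \<alpha> \<beta> x) \<le> ?J"
        using integral_decay(2)[OF pos(3,4) X0] pos(5) by (simp add: mult_left_mono)
      have "norm (integral {- ?X m..?X m} (\<lambda>x. F (of_real x)) - ?Sm)
          \<le> 2 * (?r \<delta> / (1 - ?r \<delta>) * ?J) + 3 * \<delta> * (A * decay \<alpha> \<beta> (?X m) + A * decay \<alpha> \<beta> (- ?X m))"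
        by (rule trapezoidal_rectangle_error[OF holo \<delta> pos(2) refl bound _ J])
           (auto intro!: integrable_on_mult_right integral_decay pos X0)
      moreover have "norm (?Sm - ?S) \<le> ?T"
        by (rule truncation_error[OF pos(3,4,2,6,7,8) m bound_real])
      ultimately show "norm (integral {- ?X m..?X m} (\<lambda>x. F (of_real x)) - ?S) \<le>
        2 * (?r \<delta> / (1 - ?r \<delta>) * ?J) + 3 * \<delta> * (A * decay \<alpha> \<beta> (?X m) + A * decay \<alpha> \<beta> (- ?X m)) + ?T"
        using norm_triangle_ineq[of "integral {- ?X m..?X m} (\<lambda>x. F (of_real x)) - ?Sm" "?Sm - ?S"]
        by simp
    qed
  qed
  \<comment> \<open>The bound is continuous in \<delta> up to d because \<open>1 - ?r d\<close> is
    positive.\<close>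
  have "((\<lambda>\<delta>. 2 * (?r \<delta> / (1 - ?r \<delta>) * ?J) + ?T) \<longlongrightarrow> 2 * (?r d / (1 - ?r d) * ?J) + ?T) (at_left d)"
    using pos by (intro tendsto_intros) auto
  moreover have "eventually (\<lambda>\<delta>. norm (I - ?S) \<le> 2 * (?r \<delta> / (1 - ?r \<delta>) * ?J) + ?T) (at_left d)"
    using eventually_at_left_real[OF pos(1)] by eventually_elim (rule fin, auto)
  ultimately show ?thesis unfolding \<rho>_def by (rule tendsto_lowerbound) simp
qed

text \<open>The intervals from \<psi>(-X) to \<psi>(X) increase to the open half-line. Substitution
  bounds the integral of |\<phi>| over each of them by that of the majorant, so monotone convergence
  makes |\<phi>| integrable. With |\<phi>| as dominating function, dominated convergence then gives
  both the integrability of \<phi> and the limit.\<close>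

lemma integral_halfline_substitution_limit:
  fixes \<psi> \<psi>' :: "real \<Rightarrow> real" and \<phi> :: "real \<Rightarrow> complex"
  assumes der: "\<And>x. (\<psi> has_real_derivative \<psi>' x) (at x)" and nonneg: "\<And>x. 0 \<le> \<psi>' x"
    and \<psi>pos: "\<And>x. 0 < \<psi> x" and top: "filterlim \<psi> at_top at_top" and bot: "(\<psi> \<longlongrightarrow> 0) at_bot"
    and cont: "continuous_on {0<..} \<phi>"
    and pos: "0 < h" "0 < \<alpha>" "0 < \<beta>" "0 \<le> A"
    and bound: "\<And>x. norm (of_real (\<psi>' x) * \<phi> (\<psi> x)) \<le> A * decay \<alpha> \<beta> x"
  shows "\<phi> integrable_on {0<..}"
    and "(\<lambda>m. integral {- ((real m + 1 / 2) * h)..(real m + 1 / 2) * h} (\<lambda>x. of_real (\<psi>' x) * \<phi> (\<psi> x)))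
            \<longlonglongrightarrow> integral {0<..} \<phi>"
proof -
  define X where "X = (\<lambda>m. (real m + 1 / 2) * h)"
  have X0: "0 \<le> X m" for m using pos by (simp add: X_def)
  have Xmono: "X m \<le> X (Suc m)" for m using pos by (simp add: X_def)
  have Xtop: "filterlim X at_top sequentially"
    unfolding X_def using pos(1) by (rule filterlim_half_integers)
  have mono: "\<psi> x \<le> \<psi> y" if "x \<le> y" for x y
    by (rule DERIV_nonneg_imp_nondecreasing[OF that]) (use der nonneg in blast)
  define a b where "a = (\<lambda>m. \<psi> (- X m))" and "b = (\<lambda>m. \<psi> (X m))"
  have sub: "{a m..b m} \<subseteq> {0<..}" for m using \<psi>pos[of "- X m"] by (auto simp: a_def)
  have sub_Suc: "{a m..b m} \<subseteq> {a (Suc m)..b (Suc m)}" for m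
    using mono[of "- X (Suc m)" "- X m"] mono[of "X m" "X (Suc m)"] Xmono[of m] by (auto simp: a_def b_def)
  have ev: "eventually (\<lambda>m. t \<in> {a m..b m}) sequentially" if "t > 0" for t
  proof -
    have "filterlim b at_top sequentially" unfolding b_def by (rule filterlim_compose[OF top Xtop])
    hence "eventually (\<lambda>m. t \<le> b m) sequentially" by (simp add: filterlim_at_top)
    moreover have "a \<longlonglongrightarrow> 0" unfolding a_def
      by (rule filterlim_compose[OF bot]) (use Xtop in \<open>simp add: filterlim_uminus_at_bot\<close>)
    hence "eventually (\<lambda>m. a m < t) sequentially" using that by (rule order_tendstoD)
    ultimately show ?thesis by eventually_elim auto
  qed
  have cont': "continuous_on {a m..b m} \<phi>" for m using cont sub continuous_on_subset by blast
  \<comment> \<open>The value type of \<theta> is left general, since the substitution serves both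
    \<phi> and its norm.\<close>
  have subst: "((\<lambda>x. \<psi>' x *\<^sub>R \<theta> (\<psi> x)) has_integral integral {a m..b m} \<theta>) {- X m..X m}"
    if "continuous_on {a m..b m} \<theta>" for m and \<theta> :: "real \<Rightarrow> 'b::euclidean_space"
    unfolding a_def b_def
    by (rule has_integral_substitution[where c = "a m" and d = "b m"])
       (use X0[of m] that mono in \<open>auto simp: a_def b_def intro: DERIV_subset[OF der]\<close>)
  let ?J = "A * (1 / \<alpha> + 1 / \<beta>)"
  have norm_int: "integral {a m..b m} (\<lambda>t. norm (\<phi> t)) \<le> ?J" for m
  proof -
    have c: "continuous_on {a m..b m} (\<lambda>t. norm (\<phi> t))" by (intro continuous_intros cont')
    have "integral {a m..b m} (\<lambda>t. norm (\<phi> t)) \<le> A * integral {- X m..X m} (decay \<alpha> \<beta>)"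
    proof (rule has_integral_le[OF subst[OF c]])
      show "((\<lambda>x. A * decay \<alpha> \<beta> x) has_integral A * integral {- X m..X m} (decay \<alpha> \<beta>)) {- X m..X m}"
        by (intro has_integral_mult_right integrable_integral integral_decay pos X0)
      show "\<psi>' x *\<^sub>R norm (\<phi> (\<psi> x)) \<le> A * decay \<alpha> \<beta> x" for x
        using bound[of x] nonneg[of x] by (simp add: norm_mult)
    qed
    also have "\<dots> \<le> ?J" using integral_decay(2)[OF pos(2,3) X0[of m]] pos by (intro mult_left_mono) auto
    finally show ?thesis .
  qed
  have lim_r: "(\<lambda>m. (if t \<in> {a m..b m} then \<theta> t else 0)) \<longlonglongrightarrow> \<theta> t" if "t \<in> {0<..}" for t and \<theta> :: "real \<Rightarrow> 'b::euclidean_space"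
    by (rule tendsto_eventually, rule eventually_mono[OF ev[of t]]) (use that in auto)
  have int_r: "(\<lambda>t. if t \<in> {a m..b m} then \<theta> t else 0) integrable_on {0<..}"
     "integral {0<..} (\<lambda>t. if t \<in> {a m..b m} then \<theta> t else 0) = integral {a m..b m} \<theta>"
    if "continuous_on {a m..b m} \<theta>" for m and \<theta> :: "real \<Rightarrow> 'b::euclidean_space"
    using that integrable_continuous_real[OF that] sub[of m]
    by (simp_all add: integrable_restrict_Int integral_restrict_Int Int_absorb2 del: atLeastAtMost_iff)
  have "(\<lambda>t. norm (\<phi> t)) integrable_on {0<..} \<and>
     (\<lambda>m. integral {0<..} (\<lambda>t. if t \<in> {a m..b m} then norm (\<phi> t) else 0)) \<longlonglongrightarrow> integral {0<..} (\<lambda>t. norm (\<phi> t))"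
  proof (rule monotone_convergence_increasing)
    show "(\<lambda>t. if t \<in> {a m..b m} then norm (\<phi> t) else 0) integrable_on {0<..}" for m
      by (intro int_r continuous_intros cont')
    show "(if t \<in> {a m..b m} then norm (\<phi> t) else 0) \<le> (if t \<in> {a (Suc m)..b (Suc m)} then norm (\<phi> t) else 0)" for m t
      using sub_Suc[of m] by auto
    show "(\<lambda>m. if t \<in> {a m..b m} then norm (\<phi> t) else 0) \<longlonglongrightarrow> norm (\<phi> t)" if "t \<in> {0<..}" for t
      by (rule lim_r[OF that])
    have "\<bar>integral {0<..} (\<lambda>t. if t \<in> {a m..b m} then norm (\<phi> t) else 0)\<bar> \<le> ?J" for m
    proof -
      have "integral {0<..} (\<lambda>t. if t \<in> {a m..b m} then norm (\<phi> t) else 0) = integral {a m..b m} (\<lambda>t. norm (\<phi> t))"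
        by (intro int_r continuous_intros cont')
      moreover have "0 \<le> integral {a m..b m} (\<lambda>t. norm (\<phi> t))"
        by (intro integral_nonneg integrable_continuous_real continuous_intros cont') auto
      ultimately show ?thesis using norm_int[of m] by simp
    qed
    thus "bounded (range (\<lambda>m. integral {0<..} (\<lambda>t. if t \<in> {a m..b m} then norm (\<phi> t) else 0)))"
      by (intro boundedI[of _ ?J]) auto
  qed
  hence norm_integrable: "(\<lambda>t. norm (\<phi> t)) integrable_on {0<..}" ..
  note dc = dominated_convergence[of "\<lambda>m t. if t \<in> {a m..b m} then \<phi> t else 0" "{0<..}" "\<lambda>t. norm (\<phi> t)" \<phi>,
       OF int_r(1)[OF cont'] norm_integrable _ lim_r[of _ \<phi>]]
  show "\<phi> integrable_on {0<..}" by (rule dc) auto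
  have "(\<lambda>m. integral {0<..} (\<lambda>t. if t \<in> {a m..b m} then \<phi> t else 0)) \<longlonglongrightarrow> integral {0<..} \<phi>"
    by (rule dc) auto
  moreover have "integral {0<..} (\<lambda>t. if t \<in> {a m..b m} then \<phi> t else 0) =
       integral {- X m..X m} (\<lambda>x. of_real (\<psi>' x) * \<phi> (\<psi> x))" for m
    using integral_unique[OF subst[OF cont']] int_r(2)[OF cont'] by (simp add: scaleR_conv_of_real)
  ultimately show "(\<lambda>m. integral {- ((real m + 1 / 2) * h)..(real m + 1 / 2) * h} (\<lambda>x. of_real (\<psi>' x) * \<phi> (\<psi> x)))
            \<longlonglongrightarrow> integral {0<..} \<phi>"
    by (simp add: X_def)
qed

subsection \<open>Majorants for the two transformations\<close>

text \<open>For x \<le> 0 the second factor is at most 1. For x > 0 one uses 1 + exp(2x) \<ge>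
  exp(2x), which leaves the exponent \<alpha> - (\<alpha> + \<beta>) = -\<beta>.\<close>

lemma decay_ge:
  assumes "0 < \<alpha>" "0 < \<beta>"
  shows "exp x powr \<alpha> * (1 + (exp x)\<^sup>2) powr (- ((\<alpha> + \<beta>) / 2)) \<le> decay \<alpha> \<beta> x"
proof (cases "x \<le> 0")
  case True
  have "(1 + (exp x)\<^sup>2) powr (- ((\<alpha> + \<beta>) / 2)) \<le> 1 powr (- ((\<alpha> + \<beta>) / 2))"
    using assms by (intro powr_mono2') auto
  hence "exp x powr \<alpha> * (1 + (exp x)\<^sup>2) powr (- ((\<alpha> + \<beta>) / 2)) \<le> exp x powr \<alpha> * 1"
    by (intro mult_left_mono) auto
  thus ?thesis using True by (simp add: decay_def powr_def)
next
  case False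
  have "(1 + (exp x)\<^sup>2) powr (- ((\<alpha> + \<beta>) / 2)) \<le> ((exp x)\<^sup>2) powr (- ((\<alpha> + \<beta>) / 2))"
    using assms by (intro powr_mono2') auto
  hence "exp x powr \<alpha> * (1 + (exp x)\<^sup>2) powr (- ((\<alpha> + \<beta>) / 2)) \<le> exp x powr \<alpha> * ((exp x)\<^sup>2) powr (- ((\<alpha> + \<beta>) / 2))"
    by (intro mult_left_mono) auto
  also have "\<dots> = exp (- \<beta> * x)"
    by (simp add: powr_def ln_realpow algebra_simps flip: exp_add)
  finally show ?thesis using False by (simp add: decay_def)
qed

text \<open>For w = a + ib the difference of the squares of |w| |1 + w^2| and (1 + |w|^2) a is
  exactly (b (1 - |w|^2))^2. The hypothesis places w in a sector around the positive axis; for w =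
  exp \<zeta> with \<zeta> in the strip, \<kappa> is cos d.\<close>

lemma norm_one_plus_square_ge:
  fixes w :: complex
  assumes "norm w * \<kappa> \<le> Re w" "w \<noteq> 0"
  shows "(1 + (norm w)\<^sup>2) * \<kappa> \<le> norm (1 + w\<^sup>2)"
proof -
  have sq: "((1 + (norm w)\<^sup>2) * Re w)\<^sup>2 \<le> (norm w * norm (1 + w\<^sup>2))\<^sup>2"
  proof -
    define a b where "a = Re w" and "b = Im w"
    have n: "(norm w)\<^sup>2 = a\<^sup>2 + b\<^sup>2" by (simp add: cmod_power2 a_def b_def)
    have m: "(norm (1 + w\<^sup>2))\<^sup>2 = (1 + a\<^sup>2 - b\<^sup>2)\<^sup>2 + (2 * a * b)\<^sup>2"
      unfolding cmod_power2 by (simp add: a_def b_def power2_eq_square algebra_simps)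
    have "(a\<^sup>2 + b\<^sup>2) * ((1 + a\<^sup>2 - b\<^sup>2)\<^sup>2 + (2 * a * b)\<^sup>2) - ((1 + (a\<^sup>2 + b\<^sup>2)) * a)\<^sup>2 = (b * (1 - (a\<^sup>2 + b\<^sup>2)))\<^sup>2"
      by algebra
    moreover have "(b * (1 - (a\<^sup>2 + b\<^sup>2)))\<^sup>2 \<ge> 0" by simp
    ultimately show ?thesis unfolding power_mult_distrib[of "norm w"] n m a_def[symmetric] by linarith
  qed
  have "norm w * ((1 + (norm w)\<^sup>2) * \<kappa>) = (1 + (norm w)\<^sup>2) * (norm w * \<kappa>)" by simp
  also have "\<dots> \<le> (1 + (norm w)\<^sup>2) * Re w" using assms(1) by (intro mult_left_mono) auto
  also have "\<dots> \<le> norm w * norm (1 + w\<^sup>2)" using sq by (rule power2_le_imp_le) simp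
  finally show ?thesis using assms(2) by simp
qed

lemma Re_exp_strip:
  assumes "\<zeta> \<in> strip d" "0 < d" "d < pi / 2"
  shows "norm (exp \<zeta>) * cos d \<le> Re (exp \<zeta>)" "0 < Re (exp \<zeta>)" "0 < cos d"
proof -
  have im: "\<bar>Im \<zeta>\<bar> < d" using assms by (simp add: strip_def)
  show cd: "0 < cos d" using assms by (intro cos_gt_zero) auto
  have "cos d \<le> cos \<bar>Im \<zeta>\<bar>" using im assms by (intro cos_monotone_0_pi_le) auto
  hence c: "cos d \<le> cos (Im \<zeta>)" by simp
  thus "norm (exp \<zeta>) * cos d \<le> Re (exp \<zeta>)" by (simp add: Re_exp)
  show "0 < Re (exp \<zeta>)" using c cd by (simp add: Re_exp)
qed

lemma norm_powr_of_real: "norm (z powr (of_real a :: complex)) = norm z powr a"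
  by (simp add: norm_powr_real_powr')

text \<open>The factor |exp \<zeta>| is the modulus of the derivative of the transformation and
  raises the exponent \<alpha> - 1 to \<alpha>. The parameter \<kappa> is left free: it is cos d on
  the strip and 1 on the real axis, so only the discretization term of the final constant contains a
  power of cos d.\<close>

lemma E2_bound:
  assumes "norm (exp \<zeta>) * \<kappa> \<le> Re (exp \<zeta>)" "0 < \<kappa>" "0 < \<alpha>" "0 < \<beta>"
  shows "norm (E 2 (exp \<zeta>) \<alpha> \<beta>) * norm (exp \<zeta>) \<le> \<kappa> powr (- ((\<alpha> + \<beta>) / 2)) * decay \<alpha> \<beta> (Re \<zeta>)"
proof -
  let ?W = "exp (Re \<zeta>)"
  have le: "(1 + ?W\<^sup>2) * \<kappa> \<le> norm (1 + (exp \<zeta>)\<^sup>2)"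
    using norm_one_plus_square_ge[OF assms(1)] by simp
  have "norm (E 2 (exp \<zeta>) \<alpha> \<beta>) * norm (exp \<zeta>) =
      ?W powr \<alpha> * norm (1 + (exp \<zeta>)\<^sup>2) powr (- ((\<alpha> + \<beta>) / 2))"
    unfolding E_def minus_divide_left[symmetric]
    by (simp add: norm_mult norm_powr_of_real powr_diff
          del: of_real_diff of_real_minus of_real_divide of_real_add)
  also have "\<dots> \<le> ?W powr \<alpha> * ((1 + ?W\<^sup>2) * \<kappa>) powr (- ((\<alpha> + \<beta>) / 2))"
    using le assms by (intro mult_left_mono powr_mono2') (auto intro!: mult_pos_pos add_pos_pos)
  also have "\<dots> = \<kappa> powr (- ((\<alpha> + \<beta>) / 2)) * (?W powr \<alpha> * (1 + ?W\<^sup>2) powr (- ((\<alpha> + \<beta>) / 2)))"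
    using assms by (simp add: powr_mult)
  also have "\<dots> \<le> \<kappa> powr (- ((\<alpha> + \<beta>) / 2)) * decay \<alpha> \<beta> (Re \<zeta>)"
    using assms by (intro mult_left_mono decay_ge) auto
  finally show ?thesis .
qed

section \<open>Comparison of z/(1 + z) with tanh z, and the complex arsinh\<close>

lemma sinh_le_mult_cosh:
  assumes "0 \<le> (u::real)"
  shows "sinh u \<le> u * cosh u"
proof -
  have "0 * cosh 0 - sinh 0 \<le> u * cosh u - sinh u"
  proof (rule DERIV_nonneg_imp_nondecreasing[OF assms, of "\<lambda>u. u * cosh u - sinh u"])
    fix x :: real assume "0 \<le> x"
    moreover have "((\<lambda>u. u * cosh u - sinh u) has_real_derivative x * sinh x) (at x)"
      by (auto intro!: derivative_eq_intros)
    ultimately show "\<exists>y. ((\<lambda>u. u * cosh u - sinh u) has_real_derivative y) (at x) \<and> 0 \<le> y" by auto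
  qed
  thus ?thesis by simp
qed

lemma le_sinh:
  assumes "0 \<le> (u::real)" shows "u \<le> sinh u"
  using real_le_x_sinh[OF assms] by (simp add: sinh_field_def exp_minus)

lemma norm_sinh_complex: "(norm (sinh z))\<^sup>2 = (sinh (Re z))\<^sup>2 + (sin (Im z))\<^sup>2"
  and norm_cosh_complex: "(norm (cosh z))\<^sup>2 = (sinh (Re z))\<^sup>2 + (cos (Im z))\<^sup>2"
  and Re_sinh_complex: "Re (sinh z) = sinh (Re z) * cos (Im z)"
proof -
  have s: "Re (sinh z) = sinh (Re z) * cos (Im z)" "Im (sinh z) = cosh (Re z) * sin (Im z)"
    and c: "Re (cosh z) = cosh (Re z) * cos (Im z)" "Im (cosh z) = sinh (Re z) * sin (Im z)"
    by (auto simp: sinh_field_def cosh_field_def Re_exp Im_exp field_simps)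
  have id: "(cosh (Re z))\<^sup>2 = (sinh (Re z))\<^sup>2 + 1" "(sin (Im z))\<^sup>2 = 1 - (cos (Im z))\<^sup>2"
    by (simp_all add: cosh_square_eq sin_squared_eq)
  show "(norm (sinh z))\<^sup>2 = (sinh (Re z))\<^sup>2 + (sin (Im z))\<^sup>2"
    unfolding cmod_power2 s power_mult_distrib id by (simp add: algebra_simps)
  show "(norm (cosh z))\<^sup>2 = (sinh (Re z))\<^sup>2 + (cos (Im z))\<^sup>2"
    unfolding cmod_power2 c power_mult_distrib id by (simp add: algebra_simps)
  show "Re (sinh z) = sinh (Re z) * cos (Im z)" by (rule s)
qed

lemma norm_one_plus_sq: "(norm (1 + z))\<^sup>2 = 1 + 2 * Re z + (Re z)\<^sup>2 + (Im z)\<^sup>2"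
  unfolding cmod_power2 by (simp add: power2_eq_square algebra_simps)

text \<open>This is the squared form of |z/(1 + z)| \<le> sqrt 2 |tanh z|. For z = u + iv it rests
  on u \<le> sinh u and |v| \<le> |tan v|, together with the fact that |1 + z|^2 is at least 1 and
  at least |z|^2 when u \<ge> 0. The factor 2 appears because sinh^2 u absorbs two of the three
  summands.\<close>

lemma ratio_le_tanh:
  fixes z :: complex
  assumes "0 \<le> Re z" "\<bar>Im z\<bar> < pi / 2"
  shows "(norm z)\<^sup>2 * (norm (cosh z))\<^sup>2 \<le> 2 * ((norm (sinh z))\<^sup>2 * (norm (1 + z))\<^sup>2)"
proof -
  define u v S s c where "u = Re z" "v = Im z" "S = (sinh (Re z))\<^sup>2" "s = (sin (Im z))\<^sup>2" "c = (cos (Im z))\<^sup>2"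
  have "cos v > 0" using assms by (intro cos_gt_zero_pi) (auto simp: u_v_S_s_c_def)
  hence "\<bar>v\<bar> * cos v \<le> \<bar>sin v\<bar>"
    using abs_tan_ge[of v] assms by (simp add: u_v_S_s_c_def tan_def abs_divide field_simps)
  hence vc: "v\<^sup>2 * c \<le> s"
    using \<open>cos v > 0\<close> power_mono[of "\<bar>v\<bar> * cos v" "\<bar>sin v\<bar>" 2] by (simp add: power_mult_distrib u_v_S_s_c_def)
  have uS: "u\<^sup>2 \<le> S" using le_sinh[of u] assms by (auto simp: u_v_S_s_c_def intro!: power_mono)
  have nn: "0 \<le> u" "0 \<le> S" "0 \<le> s" "0 \<le> c" "c \<le> 1"
    using assms by (auto simp: u_v_S_s_c_def abs_square_le_1)
  let ?q = "1 + 2 * u + u\<^sup>2 + v\<^sup>2"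
  have q1: "1 \<le> ?q" using nn by simp
  have "(u\<^sup>2 + v\<^sup>2) * (S + c) = (u\<^sup>2 + v\<^sup>2) * S + u\<^sup>2 * c + v\<^sup>2 * c" by (simp add: algebra_simps)
  also have "(u\<^sup>2 + v\<^sup>2) * S \<le> ?q * S" using nn by (intro mult_right_mono) auto
  also have "u\<^sup>2 * c \<le> S * ?q"
    using uS nn q1 by (intro mult_mono order_trans[OF \<open>c \<le> 1\<close> q1]) auto
  also have "v\<^sup>2 * c \<le> 2 * (s * ?q)"
  proof -
    have "s * 1 \<le> s * ?q" using nn by (intro mult_left_mono) auto
    thus ?thesis using vc nn by linarith
  qed
  finally have "(u\<^sup>2 + v\<^sup>2) * (S + c) \<le> 2 * ((S + s) * ?q)" by (simp add: algebra_simps)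
  thus ?thesis unfolding norm_sinh_complex norm_cosh_complex norm_one_plus_sq cmod_power2[of z] u_v_S_s_c_def .
qed

text \<open>
  The plain estimate \<open>|tanh z| \<le> |z|\<close> fails near the imaginary axis. There the sector condition
  \<open>\<kappa> |sinh z| \<le> Re (sinh z) = sinh u cos v\<close> compensates, through
  \<open>|sin v| \<le> |sinh z| \<le> sinh u cos v / \<kappa> \<le> |cosh z|\<^sup>2 / (2\<kappa>)\<close> for \<open>z = u + iv\<close>.
\<close>

lemma tanh_le_ratio:
  fixes z :: complex
  assumes u0: "0 < Re z" and v0: "\<bar>Im z\<bar> < pi / 2" and \<kappa>: "0 < \<kappa>" "norm (sinh z) * \<kappa> \<le> Re (sinh z)"
  shows "(norm (sinh z))\<^sup>2 * (norm (1 + z))\<^sup>2 \<le> 2 * (1 + 1 / \<kappa>) * ((norm z)\<^sup>2 * (norm (cosh z))\<^sup>2)"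
proof -
  define u v W S where "u = Re z" and "v = Im z" and "W = norm (sinh z)" and "S = (norm (cosh z))\<^sup>2"
  define sh s c where "sh = sinh u" and "s = sin v" and "c = cos v"
  have W2: "W\<^sup>2 = sh\<^sup>2 + s\<^sup>2" and Seq: "S = sh\<^sup>2 + c\<^sup>2"
    by (simp_all add: W_def S_def norm_sinh_complex norm_cosh_complex u_def v_def sh_def s_def c_def)
  have sc: "s\<^sup>2 + c\<^sup>2 = 1" by (simp add: s_def c_def)
  have upos: "u > 0" using u0 by (simp add: u_def)
  have "sh > 0" using upos by (simp add: sh_def)
  hence "W\<^sup>2 > 0" unfolding W2 by (intro add_pos_nonneg) auto
  hence "W > 0" by (simp add: W_def)
  have S0: "S \<ge> 0" by (simp add: S_def)
  have cosh2: "(cosh z)\<^sup>2 = 1 + (sinh z)\<^sup>2" by (simp add: cosh_square_eq)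
  \<comment> \<open>Since (cosh z)^2 = 1 + (sinh z)^2, the sector inequality applies to w = sinh
    z.\<close>
  have "(1 + W\<^sup>2) * \<kappa> \<le> S"
  proof -
    have "sinh z \<noteq> 0" using \<open>W > 0\<close> by (auto simp: W_def)
    from norm_one_plus_square_ge[OF \<kappa>(2) this] show ?thesis
      unfolding S_def W_def norm_power[symmetric] cosh2 .
  qed
  hence a: "W\<^sup>2 \<le> S / \<kappa>" using \<kappa> by (simp add: field_simps)
  have u_sh: "u\<^sup>2 \<le> sh\<^sup>2" using le_sinh[of u] upos by (auto simp: sh_def intro!: power_mono)
  have "\<bar>s\<bar> \<le> W"
  proof (rule power2_le_imp_le)
    show "\<bar>s\<bar>\<^sup>2 \<le> W\<^sup>2" unfolding W2 by simp
  qed (use \<open>W > 0\<close> in simp)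
  also have "\<dots> \<le> sh * c / \<kappa>"
    using \<kappa> by (simp add: W_def Re_sinh_complex sh_def c_def u_def v_def field_simps)
  also have "\<dots> \<le> S / 2 / \<kappa>"
    using \<kappa> sum_squares_bound[of sh c] by (intro divide_right_mono) (auto simp: Seq)
  finally have s_le: "\<bar>s\<bar> \<le> S / (2 * \<kappa>)" by simp
  \<comment> \<open>Write 1 = s^2 + c^2. Here s^2 \<le> |s| is covered by \<open>s_le\<close>, while
    c^2 together with sinh^2 u makes up \<open>S\<close>.\<close>
  have "s\<^sup>2 \<le> \<bar>s\<bar>"
    using mult_right_le_one_le[of "\<bar>s\<bar>" "\<bar>s\<bar>"] by (simp add: s_def power2_eq_square abs_mult[symmetric])
  hence c1: "1 + u\<^sup>2 \<le> S + S / (2 * \<kappa>)" using s_le u_sh Seq sc by linarith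
  have sv: "s\<^sup>2 \<le> v\<^sup>2" using abs_sin_x_le_abs_x[of v] by (simp add: s_def abs_le_square_iff)
  have "sh\<^sup>2 \<le> (u * cosh u)\<^sup>2"
    using sinh_le_mult_cosh[of u] upos by (auto simp: sh_def intro!: power_mono)
  also have "\<dots> = u\<^sup>2 * (S + s\<^sup>2)"
    using sc by (simp add: power_mult_distrib cosh_square_eq Seq sh_def)
  finally have sh_le: "sh\<^sup>2 \<le> u\<^sup>2 * (S + s\<^sup>2)" .
  have "(1 + u\<^sup>2) * s\<^sup>2 \<le> (S + S / (2 * \<kappa>)) * v\<^sup>2"
    using c1 sv S0 \<kappa> by (intro mult_mono) (auto intro!: add_nonneg_nonneg divide_nonneg_pos)
  hence b: "W\<^sup>2 \<le> S * (u\<^sup>2 + v\<^sup>2) + (S / (2 * \<kappa>)) * v\<^sup>2"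
    using sh_le unfolding W2 by (simp add: algebra_simps)
  \<comment> \<open>Using 2u \<le> 1 + u^2, the constant part of the second factor is paired with
    \<open>b\<close> and the quadratic part with \<open>a\<close>. The weights 2u^2 and v^2 are what
    makes both coefficients come out as 2(1 + 1/\<kappa>).\<close>
  have "W\<^sup>2 * (1 + 2 * u + u\<^sup>2 + v\<^sup>2) \<le> W\<^sup>2 * (2 + (2 * u\<^sup>2 + v\<^sup>2))"
    using sum_squares_bound[of u 1] by (intro mult_left_mono) auto
  also have "\<dots> = 2 * W\<^sup>2 + W\<^sup>2 * (2 * u\<^sup>2 + v\<^sup>2)" by (simp add: algebra_simps)
  also have "\<dots> \<le> 2 * (S * (u\<^sup>2 + v\<^sup>2) + (S / (2 * \<kappa>)) * v\<^sup>2) + S / \<kappa> * (2 * u\<^sup>2 + v\<^sup>2)"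
    using a b by (intro add_mono mult_left_mono mult_right_mono) auto
  also have "\<dots> = 2 * (1 + 1 / \<kappa>) * ((u\<^sup>2 + v\<^sup>2) * S)" using \<kappa> by (simp add: field_simps)
  finally show ?thesis
    by (simp add: norm_one_plus_sq cmod_power2[of z] W_def S_def u_def v_def)
qed

text \<open>Let s be the principal root of w^2 + 1, so that arsinh w = Ln (w + s). From (w + s)(s -
  w) = 1 one reads off sinh = w and cosh = s. Since Re s \<ge> 0, w + s lies in the right
  half-plane, which bounds the imaginary part; then Re w = sinh(Re z) cos(Im z) > 0, with z = arsinh
  w, forces Re z > 0.\<close>

lemma arsinh_complex_right_half_plane:
  fixes w :: complex
  assumes "0 < Re w"
  shows "sinh (arsinh w) = w" "0 < Re (arsinh w)" "\<bar>Im (arsinh w)\<bar> < pi / 2"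
    and "(arsinh has_field_derivative 1 / cosh (arsinh w)) (at w)"
proof -
  \<comment> \<open>The imaginary part 2 Re w Im w vanishes only for real w, and then w^2 + 1 > 0.
    So the root stays off its branch cut.\<close>
  have nonpos: "w\<^sup>2 + 1 \<notin> \<real>\<^sub>\<le>\<^sub>0"
  proof
    assume "w\<^sup>2 + 1 \<in> \<real>\<^sub>\<le>\<^sub>0"
    hence "Re (w\<^sup>2 + 1) \<le> 0" "Im (w\<^sup>2 + 1) = 0" by (simp_all add: complex_nonpos_Reals_iff)
    hence "(Re w)\<^sup>2 - (Im w)\<^sup>2 + 1 \<le> 0" "Im w = 0" using assms by (simp_all add: power2_eq_square)
    thus False using zero_le_power2[of "Re w"] by auto
  qed
  define s where "s = csqrt (w\<^sup>2 + 1)"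
  have s2: "s\<^sup>2 = w\<^sup>2 + 1" by (simp add: s_def)
  have as: "arsinh w = Ln (w + s)" by (simp add: arsinh_def s_def csqrt_conv_powr)
  have "Re s \<ge> 0" unfolding s_def using csqrt_principal[of "w\<^sup>2 + 1"] by auto
  hence re: "Re (w + s) > 0" using assms by simp
  hence ne: "w + s \<noteq> 0" by (metis less_irrefl zero_complex.simps(1))
  have ex: "exp (arsinh w) = w + s" unfolding as using ne by (rule exp_Ln)
  have "(w + s) * (s - w) = 1" using s2 by (simp add: algebra_simps power2_eq_square)
  hence "inverse (w + s) = s - w" by (rule inverse_unique)
  hence ex': "exp (- arsinh w) = s - w" by (simp add: exp_minus ex)
  show sinh: "sinh (arsinh w) = w" by (simp add: sinh_field_def ex ex')
  have cosh: "cosh (arsinh w) = s" by (simp add: cosh_field_def ex ex')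
  show im: "\<bar>Im (arsinh w)\<bar> < pi / 2" unfolding as using re by (rule Re_Ln_pos_lt_imp)
  have "cos (Im (arsinh w)) > 0" using im by (intro cos_gt_zero_pi) auto
  moreover have "sinh (Re (arsinh w)) * cos (Im (arsinh w)) > 0"
    using Re_sinh_complex[of "arsinh w"] sinh assms by simp
  ultimately show "0 < Re (arsinh w)" by (simp add: zero_less_mult_iff)
  have sne: "s \<noteq> 0" using nonpos s_def by auto
  have nonpos': "w + s \<notin> \<real>\<^sub>\<le>\<^sub>0" using re by (auto simp: complex_nonpos_Reals_iff)
  have "((\<lambda>w. Ln (w + csqrt (w\<^sup>2 + 1))) has_field_derivative (1 + 2 * w / (2 * s)) / (w + s)) (at w)"
    using nonpos nonpos' unfolding s_def by (auto intro!: derivative_eq_intros simp: field_simps)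
  also have "(1 + 2 * w / (2 * s)) / (w + s) = 1 / s"
  proof -
    have "1 + 2 * w / (2 * s) = (w + s) / s" using sne by (simp add: field_simps)
    thus ?thesis using ne by simp
  qed
  also have "(\<lambda>w. Ln (w + csqrt (w\<^sup>2 + 1))) = arsinh"
    by (auto simp: arsinh_def csqrt_conv_powr)
  finally show "(arsinh has_field_derivative 1 / cosh (arsinh w)) (at w)" unfolding cosh .
qed

section \<open>The weight of the arsinh transformation\<close>

lemma powr_ratio_le:
  fixes R T a \<alpha> :: real
  assumes "0 < R" "0 < T" "0 < a"
  shows "1 \<le> \<alpha> \<Longrightarrow> R \<le> a * T \<Longrightarrow> R powr (\<alpha> - 1) \<le> a powr (\<alpha> - 1) * T powr (\<alpha> - 1)"
    and "\<alpha> < 1 \<Longrightarrow> T \<le> a * R \<Longrightarrow> R powr (\<alpha> - 1) \<le> a powr (1 - \<alpha>) * T powr (\<alpha> - 1)"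
proof -
  assume "1 \<le> \<alpha>" "R \<le> a * T"
  hence "R powr (\<alpha> - 1) \<le> (a * T) powr (\<alpha> - 1)" using assms by (intro powr_mono2) auto
  thus "R powr (\<alpha> - 1) \<le> a powr (\<alpha> - 1) * T powr (\<alpha> - 1)" using assms by (simp add: powr_mult)
next
  assume "\<alpha> < 1" "T \<le> a * R"
  hence "R powr (\<alpha> - 1) \<le> (T / a) powr (\<alpha> - 1)"
    using assms by (intro powr_mono2') (auto simp: field_simps)
  also have "\<dots> = T powr (\<alpha> - 1) / a powr (\<alpha> - 1)" using assms by (simp add: powr_divide)
  also have "\<dots> = a powr (1 - \<alpha>) * T powr (\<alpha> - 1)"
    using powr_minus_divide[of a "\<alpha> - 1"] by simp
  finally show "R powr (\<alpha> - 1) \<le> a powr (1 - \<alpha>) * T powr (\<alpha> - 1)" .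
qed

text \<open>In the applications R = |z/(1 + z)|, T = |tanh z|, S = |cosh z|^2, u = Re z and x = Re
  \<zeta>. Trading R for T leaves T^\<alpha> exp(-\<beta>u). With Q = (1 + exp(2x))\<kappa> one has
  T^2 \<le> exp(2x)/Q and exp(2u) \<ge> Q, so the product is at most exp(\<alpha>x)
  Q^(-(\<alpha>+\<beta>)/2), the profile already met in \<open>decay_ge\<close>.\<close>

lemma weight_le_decay:
  assumes "0 < T" "T\<^sup>2 * S = (exp x)\<^sup>2" "0 < \<kappa>" "0 < \<alpha>" "0 < \<beta>" "0 \<le> C"
    and S: "(1 + (exp x)\<^sup>2) * \<kappa> \<le> S" and u: "(1 + (exp x)\<^sup>2) * \<kappa> \<le> exp (2 * u)"
    and R: "R powr (\<alpha> - 1) \<le> C * T powr (\<alpha> - 1)"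
  shows "R powr (\<alpha> - 1) * exp (- \<beta> * u) * T \<le> C * \<kappa> powr (- ((\<alpha> + \<beta>) / 2)) * decay \<alpha> \<beta> x"
proof -
  let ?W = "exp x" and ?Q = "(1 + (exp x)\<^sup>2) * \<kappa>"
  have Q: "?Q > 0" using assms by (intro mult_pos_pos add_pos_pos) auto
  have "T\<^sup>2 = ?W\<^sup>2 / S" using assms(2) Q S by (simp add: field_simps)
  also have "\<dots> \<le> ?W\<^sup>2 / ?Q" using Q S by (intro divide_left_mono) auto
  finally have T2: "T\<^sup>2 \<le> ?W\<^sup>2 / ?Q" .
  have "T powr \<alpha> = (T\<^sup>2) powr (\<alpha> / 2)" using assms(1) by (simp add: powr_powr flip: powr_numeral)
  also have "\<dots> \<le> (?W\<^sup>2 / ?Q) powr (\<alpha> / 2)" using T2 assms by (intro powr_mono2) auto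
  also have "\<dots> = ?W powr \<alpha> * ?Q powr (- (\<alpha> / 2))"
  proof -
    have "(?W\<^sup>2) powr (\<alpha> / 2) = ?W powr \<alpha>" by (simp add: powr_powr flip: powr_numeral)
    thus ?thesis using Q by (simp add: powr_divide powr_minus_divide del: exp_ge_zero)
  qed
  finally have Ta: "T powr \<alpha> \<le> ?W powr \<alpha> * ?Q powr (- (\<alpha> / 2))" .
  have "exp (- \<beta> * u) = exp (2 * u) powr (- (\<beta> / 2))" by (simp add: powr_def)
  also have "\<dots> \<le> ?Q powr (- (\<beta> / 2))" using u Q assms by (intro powr_mono2') auto
  finally have eu: "exp (- \<beta> * u) \<le> ?Q powr (- (\<beta> / 2))" .
  have "R powr (\<alpha> - 1) * exp (- \<beta> * u) * T \<le> C * T powr (\<alpha> - 1) * exp (- \<beta> * u) * T"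
    using R assms(1) by (intro mult_right_mono) auto
  also have "\<dots> = C * (T powr \<alpha> * exp (- \<beta> * u))" using assms(1) by (simp add: powr_diff)
  also have "\<dots> \<le> C * ((?W powr \<alpha> * ?Q powr (- (\<alpha> / 2))) * ?Q powr (- (\<beta> / 2)))"
    using Ta eu assms by (intro mult_left_mono mult_mono) auto
  also have "(?W powr \<alpha> * ?Q powr (- (\<alpha> / 2))) * ?Q powr (- (\<beta> / 2)) = ?W powr \<alpha> * ?Q powr (- ((\<alpha> + \<beta>) / 2))"
  proof -
    have "- ((\<alpha> + \<beta>) / 2) = - (\<alpha> / 2) + - (\<beta> / 2)" by (simp add: field_simps)
    thus ?thesis by (simp only: powr_add mult.assoc)
  qed
  also have "?Q powr (- ((\<alpha> + \<beta>) / 2)) = (1 + ?W\<^sup>2) powr (- ((\<alpha> + \<beta>) / 2)) * \<kappa> powr (- ((\<alpha> + \<beta>) / 2))"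
    by (rule powr_mult)
  also have "C * (?W powr \<alpha> * \<dots>) = C * \<kappa> powr (- ((\<alpha> + \<beta>) / 2)) * (?W powr \<alpha> * (1 + ?W\<^sup>2) powr (- ((\<alpha> + \<beta>) / 2)))"
    by simp
  also have "\<dots> \<le> C * \<kappa> powr (- ((\<alpha> + \<beta>) / 2)) * decay \<alpha> \<beta> x"
    using assms by (intro mult_left_mono decay_ge) auto
  finally show ?thesis .
qed

lemma norm_E3:
  "norm (E 3 z \<alpha> \<beta>) = norm (z / (1 + z)) powr (\<alpha> - 1) * exp (- \<beta> * Re z)"
  unfolding E_def by (simp add: norm_mult norm_powr_of_real del: of_real_diff)

text \<open>As sinh z = exp \<zeta>, the second factor is |tanh z|, the modulus of the derivative of
  the transformation. For \<alpha> < 1 the exponent \<alpha> - 1 is negative, so tanh must be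
  bounded by the ratio; otherwise the ratio is bounded by tanh. The square roots of the two
  comparison constants, raised to |\<alpha> - 1|, are the two branches of
  \<open>c_ad\<close>.\<close>

lemma E3_bound:
  assumes \<zeta>: "\<zeta> \<in> strip d" and d: "0 < d" "d < pi / 2" and pos: "0 < \<alpha>" "0 < \<beta>"
  defines "z \<equiv> arsinh (exp \<zeta>)"
  shows "norm (E 3 z \<alpha> \<beta>) * norm (exp \<zeta> / cosh z) \<le> c_ad \<alpha> d * cos d powr (- ((\<alpha> + \<beta>) / 2)) * decay \<alpha> \<beta> (Re \<zeta>)"
proof -
  note w = Re_exp_strip[OF \<zeta> d]
  note ar = arsinh_complex_right_half_plane[OF w(2), folded z_def]
  define R T where "R = norm (z / (1 + z))" and "T = norm (exp \<zeta> / cosh z)"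
  have cosh2: "(cosh z)\<^sup>2 = 1 + (exp \<zeta>)\<^sup>2" by (simp add: cosh_square_eq ar)
  have S: "(1 + (exp (Re \<zeta>))\<^sup>2) * cos d \<le> (norm (cosh z))\<^sup>2"
    using norm_one_plus_square_ge[OF w(1)] unfolding norm_power[symmetric] cosh2 by (simp add: norm_power)
  have "(1 + (exp (Re \<zeta>))\<^sup>2) * cos d > 0" using w(3) by (intro mult_pos_pos add_pos_pos) auto
  with S have cz: "cosh z \<noteq> 0" by auto
  have z1: "z \<noteq> 0" "1 + z \<noteq> 0" using ar(2) by (auto simp: complex_eq_iff)
  have RT: "R > 0" "T > 0" using z1 cz by (simp_all add: R_def T_def)
  \<comment> \<open>The chain |cosh z| \<le> cosh(Re z) \<le> exp(Re z) turns the lower bound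
    \<open>S\<close> into the one on exp(2 Re z) that controls the factor exp(-\<beta> Re
    z).\<close>
  have "(norm (cosh z))\<^sup>2 \<le> (sinh (Re z))\<^sup>2 + 1"
    unfolding norm_cosh_complex by (simp add: abs_square_le_1)
  also have "\<dots> = (cosh (Re z))\<^sup>2" by (simp add: cosh_square_eq)
  also have "\<dots> \<le> (exp (Re z))\<^sup>2"
    using ar(2) by (intro power_mono) (auto simp: cosh_field_def)
  also have "\<dots> = exp (2 * Re z)" by (simp add: exp_double)
  finally have u: "(1 + (exp (Re \<zeta>))\<^sup>2) * cos d \<le> exp (2 * Re z)" using S by linarith
  have TS: "T\<^sup>2 * (norm (cosh z))\<^sup>2 = (exp (Re \<zeta>))\<^sup>2"
    using cz by (simp add: T_def norm_divide power_divide)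
  have c0: "0 \<le> c_ad \<alpha> d" by (simp add: c_ad_def)
  have R_le: "R powr (\<alpha> - 1) \<le> c_ad \<alpha> d * T powr (\<alpha> - 1)"
  proof (cases "\<alpha> < 1")
    case True
    let ?a = "2 * (1 + 1 / cos d)"
    have a: "?a > 0" using w(3) by (simp add: add_pos_pos)
    have "(norm (exp \<zeta>))\<^sup>2 * (norm (1 + z))\<^sup>2 \<le> ?a * ((norm z)\<^sup>2 * (norm (cosh z))\<^sup>2)"
      using tanh_le_ratio[OF ar(2,3) w(3)] w(1) by (simp add: ar(1))
    hence "T\<^sup>2 \<le> ?a * R\<^sup>2"
      using z1 cz unfolding T_def R_def norm_divide power_divide by (simp add: field_simps)
    hence "sqrt (T\<^sup>2) \<le> sqrt (?a * R\<^sup>2)" by (rule real_sqrt_le_mono)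
    hence "T \<le> sqrt ?a * R" using RT by (simp only: real_sqrt_mult real_sqrt_abs abs_of_pos)
    hence "R powr (\<alpha> - 1) \<le> sqrt ?a powr (1 - \<alpha>) * T powr (\<alpha> - 1)"
      using RT a True by (intro powr_ratio_le) auto
    also have "sqrt ?a powr (1 - \<alpha>) = c_ad \<alpha> d"
      using True a by (simp add: c_ad_def powr_half_sqrt[symmetric] powr_powr)
    finally show ?thesis .
  next
    case False
    have "(norm z)\<^sup>2 * (norm (cosh z))\<^sup>2 \<le> 2 * ((norm (exp \<zeta>))\<^sup>2 * (norm (1 + z))\<^sup>2)"
      using ratio_le_tanh[of z] ar by simp
    hence "R\<^sup>2 \<le> 2 * T\<^sup>2"
      using z1 cz unfolding T_def R_def norm_divide power_divide by (simp add: field_simps)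
    hence "sqrt (R\<^sup>2) \<le> sqrt (2 * T\<^sup>2)" by (rule real_sqrt_le_mono)
    hence "R \<le> sqrt 2 * T" using RT by (simp only: real_sqrt_mult real_sqrt_abs abs_of_pos)
    hence "R powr (\<alpha> - 1) \<le> sqrt 2 powr (\<alpha> - 1) * T powr (\<alpha> - 1)"
      using RT False by (intro powr_ratio_le) auto
    also have "sqrt 2 powr (\<alpha> - 1) = c_ad \<alpha> d"
      using False by (simp add: c_ad_def powr_half_sqrt[symmetric] powr_powr)
    finally show ?thesis .
  qed
  show ?thesis
    using weight_le_decay[OF RT(2) TS w(3) pos c0 S u R_le] by (simp add: norm_E3 R_def T_def)
qed

lemma arsinh_of_real:
  assumes "0 < (x::real)"
  shows "arsinh (complex_of_real x) = of_real (arsinh x)"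
proof -
  have "complex_of_real (x\<^sup>2 + 1) powr of_real (1/2) = of_real ((x\<^sup>2 + 1) powr (1/2))"
    by (rule powr_of_real) simp
  hence "((complex_of_real x)\<^sup>2 + 1) powr of_real (1/2) = of_real ((x\<^sup>2 + 1) powr (1/2))"
    by (simp only: of_real_add of_real_power of_real_1)
  thus ?thesis unfolding arsinh_def
    using arsinh_real_aux[of x] by (simp add: powr_half_sqrt Ln_of_real flip: of_real_add)
qed

lemma cosh_complex_of_real: "cosh (complex_of_real t) = of_real (cosh t)"
  by (simp add: cosh_field_def exp_of_real flip: of_real_minus)

text \<open>On the real axis \<kappa> = 1 is available, and with R = t/(1 + t) and T = tanh t the
  comparisons are T \<le> 2R and R \<le> T. The resulting constant is 2^(1-\<alpha>) for \<alpha> <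
  1 and 1 otherwise; the absolute value in the exponent merges the two cases.\<close>

lemma E3_bound_real:
  fixes x :: real
  assumes pos: "0 < \<alpha>" "0 < \<beta>"
  defines "z \<equiv> complex_of_real (arsinh (exp x))"
  shows "norm (E 3 z \<alpha> \<beta>) * norm (exp (of_real x) / cosh z) \<le> 2 powr ((1 - \<alpha> + \<bar>1 - \<alpha>\<bar>) / 2) * decay \<alpha> \<beta> x"
proof -
  define t where "t = arsinh (exp x)"
  have t: "t > 0" "sinh t = exp x" by (simp_all add: t_def)
  define R T where "R = t / (1 + t)" and "T = exp x / cosh t"
  have RT: "R > 0" "T > 0" using t by (simp_all add: R_def T_def)
  have cosh2: "(cosh t)\<^sup>2 = 1 + (exp x)\<^sup>2" by (simp add: cosh_square_eq t)
  have TS: "T\<^sup>2 * (cosh t)\<^sup>2 = (exp x)\<^sup>2" by (simp add: T_def power_divide)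
  have u: "(1 + (exp x)\<^sup>2) * 1 \<le> exp (2 * t)"
  proof -
    have "(cosh t)\<^sup>2 \<le> (exp t)\<^sup>2" using t by (intro power_mono) (auto simp: cosh_field_def)
    thus ?thesis by (simp add: cosh2 exp_double)
  qed
  have R_le: "R powr (\<alpha> - 1) \<le> 2 powr ((1 - \<alpha> + \<bar>1 - \<alpha>\<bar>) / 2) * T powr (\<alpha> - 1)"
  proof (cases "\<alpha> < 1")
    case True
    have "T \<le> 2 * R"
    proof (cases "t \<le> 1")
      case True
      have "T \<le> t" using sinh_le_mult_cosh[of t] t by (simp add: T_def field_simps)
      also have "t \<le> 2 * R" using True t by (simp add: R_def field_simps)
      finally show ?thesis .
    next
      case False
      have "T \<le> 1" using sinh_le_cosh_real[of t] t by (simp add: T_def)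
      also have "1 \<le> 2 * R" using False t by (simp add: R_def field_simps)
      finally show ?thesis .
    qed
    moreover have "(1 - \<alpha> + \<bar>1 - \<alpha>\<bar>) / 2 = 1 - \<alpha>" using True by simp
    ultimately show ?thesis using powr_ratio_le(2)[OF RT, of 2 \<alpha>] True by (simp only:)
  next
    case False
    \<comment> \<open>Since exp(-t) = cosh t - sinh t, this rearranges to t cosh t \<le> (1 + t)
      sinh t, which is R \<le> T.\<close>
    have "t * exp (- t) \<le> t * 1" using t by (intro mult_left_mono) auto
    also have "\<dots> \<le> sinh t" using le_sinh[of t] t by simp
    finally have "t * (cosh t - sinh t) \<le> sinh t" by (simp add: cosh_minus_sinh)
    hence "R \<le> 1 * T" using t by (simp add: R_def T_def field_simps)
    from powr_ratio_le(1)[OF RT _ _ this, of \<alpha>] False show ?thesis by simp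
  qed
  have "R powr (\<alpha> - 1) * exp (- \<beta> * t) * T \<le> 2 powr ((1 - \<alpha> + \<bar>1 - \<alpha>\<bar>) / 2) * 1 powr (- ((\<alpha> + \<beta>) / 2)) * decay \<alpha> \<beta> x"
    by (rule weight_le_decay[OF RT(2) TS _ pos _ _ u R_le]) (simp_all add: cosh2)
  moreover have "norm (z / (1 + z)) = R"
  proof -
    have "z / (1 + z) = of_real (t / (1 + t))" by (simp add: z_def t_def)
    thus ?thesis using t by (simp add: R_def del: of_real_divide)
  qed
  moreover have "norm (exp (of_real x) / cosh z) = T"
  proof -
    have "cosh z = of_real (cosh t)" by (simp add: z_def t_def cosh_complex_of_real)
    hence "exp (of_real x) / cosh z = of_real T" by (simp add: T_def exp_of_real)
    thus ?thesis using RT by simp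
  qed
  ultimately show ?thesis by (simp add: norm_E3 z_def t_def)
qed

section \<open>Balancing the two errors by the choice of h, M and N\<close>

lemma le_mult_ceiling_divide:
  assumes "0 < (a::real)"
  shows "b \<le> a * of_int \<lceil>b / a\<rceil>"
  using le_of_int_ceiling[of "b / a"] assms by (simp only: pos_divide_le_eq mult.commute)

text \<open>The step h is chosen so that 2 pi d/h = \<mu>nh = sqrt(2 pi d \<mu> n), which gives both
  errors the same exponential rate. Rounding up in \<open>M\<close> and \<open>N\<close> ensures
  that \<alpha>M and \<beta>N are at least \<mu>n, and 1/\<alpha> + 1/\<beta> \<le> 2/\<mu> yields
  the common prefactor.\<close>

lemma mapped_sinc_quadrature_error:
  fixes f \<Psi> :: "complex \<Rightarrow> complex" and \<psi> \<psi>' :: "real \<Rightarrow> real" and n :: nat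
  assumes d: "0 < d" and pos: "0 < \<alpha>" "0 < \<beta>" "0 \<le> A" "0 \<le> B" and n: "0 < n"
    and \<Psi>: "\<Psi> analytic_on strip d" and f: "f analytic_on \<Psi> ` strip d"
    and bound: "\<And>\<zeta>. \<zeta> \<in> strip d \<Longrightarrow> norm (f (\<Psi> \<zeta>) * deriv \<Psi> \<zeta>) \<le> A * decay \<alpha> \<beta> (Re \<zeta>)"
    and bound_real: "\<And>x. norm (f (\<Psi> (of_real x)) * deriv \<Psi> (of_real x)) \<le> B * decay \<alpha> \<beta> x"
    and \<psi>: "\<And>x. \<Psi> (of_real x) = of_real (\<psi> x)" "\<And>x. deriv \<Psi> (of_real x) = of_real (\<psi>' x)"
    and der: "\<And>x. (\<psi> has_real_derivative \<psi>' x) (at x)" and nonneg: "\<And>x. 0 \<le> \<psi>' x"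
    and \<psi>pos: "\<And>x. 0 < \<psi> x" and surj: "\<And>t. 0 < t \<Longrightarrow> \<exists>x. \<psi> x = t"
    and top: "filterlim \<psi> at_top at_top" and bot: "(\<psi> \<longlongrightarrow> 0) at_bot"
  defines "\<mu> \<equiv> min \<alpha> \<beta>"
  defines "h \<equiv> sqrt (2 * pi * d / (\<mu> * real n))"
  defines "M \<equiv> (if \<mu> = \<alpha> then int n else \<lceil>\<beta> * real n / \<alpha>\<rceil>)"
  defines "N \<equiv> (if \<mu> = \<alpha> then \<lceil>\<alpha> * real n / \<beta>\<rceil> else int n)"
  shows "(\<lambda>t. f (of_real t)) integrable_on {0<..}"
    and "norm (integral {0<..} (\<lambda>t. f (of_real t))
           - of_real h * (\<Sum>k = -M..N. f (\<Psi> (of_real (of_int k * h))) * deriv \<Psi> (of_real (of_int k * h))))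
         \<le> 2 / \<mu> * (2 * A / (1 - exp (- sqrt (2 * pi * d * \<mu>))) + B) * exp (- sqrt (2 * pi * d * \<mu> * real n))"
proof -
  have \<mu>: "0 < \<mu>" "\<mu> \<le> \<alpha>" "\<mu> \<le> \<beta>" using pos by (auto simp: \<mu>_def)
  have n1: "1 \<le> real n" using n by simp
  have h: "0 < h" unfolding h_def using d \<mu> n by simp
  define F where "F = (\<lambda>\<zeta>. f (\<Psi> \<zeta>) * deriv \<Psi> \<zeta>)"
  have "(f \<circ> \<Psi>) analytic_on strip d" using \<Psi> f by (rule analytic_on_compose)
  hence "(\<lambda>\<zeta>. (f \<circ> \<Psi>) \<zeta> * deriv \<Psi> \<zeta>) analytic_on strip d"
    by (intro analytic_on_mult analytic_deriv \<Psi>)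
  hence holo: "F holomorphic_on strip d"
    unfolding F_def o_def by (rule analytic_imp_holomorphic)
  have F_real: "of_real (\<psi>' x) * f (of_real (\<psi> x)) = F (of_real x)" for x
    by (simp add: F_def \<psi> mult.commute)
  \<comment> \<open>The function f is given only on the image of the strip, so the half-line of
    integration must be located inside it.\<close>
  have sub: "complex_of_real ` {0<..} \<subseteq> \<Psi> ` strip d"
  proof
    fix y assume "y \<in> complex_of_real ` {0<..}"
    then obtain t where t: "t > 0" "y = of_real t" by auto
    then obtain x where "\<psi> x = t" using surj by blast
    hence "y = \<Psi> (of_real x)" using t \<psi> by simp
    moreover have "complex_of_real x \<in> strip d" using d by (simp add: strip_def)
    ultimately show "y \<in> \<Psi> ` strip d" by blast
  qed
  have cont: "continuous_on {0<..} (\<lambda>t. f (of_real t))"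
    by (rule continuous_on_compose2[OF holomorphic_on_imp_continuous_on[OF analytic_imp_holomorphic[OF f]] _ sub])
       (intro continuous_intros)
  have bound_r: "norm (of_real (\<psi>' x) * f (of_real (\<psi> x))) \<le> B * decay \<alpha> \<beta> x" for x
    using bound_real[of x] unfolding F_real by (simp add: F_def)
  note sl = integral_halfline_substitution_limit[OF der nonneg \<psi>pos top bot cont h pos(1,2,4) bound_r, unfolded F_real]
  show "(\<lambda>t. f (of_real t)) integrable_on {0<..}" by (rule sl(1))
  define L where "L = sqrt (2 * pi * d * \<mu> * real n)"
  have hh: "h\<^sup>2 = 2 * pi * d / (\<mu> * real n)" using d \<mu> by (simp add: h_def)
  have "(\<mu> * real n * h)\<^sup>2 = 2 * pi * d * \<mu> * real n"
    unfolding power_mult_distrib hh using \<mu> n1 by (simp add: field_simps power2_eq_square)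
  hence L1: "\<mu> * real n * h = L" unfolding L_def using \<mu> h by (intro real_sqrt_unique[symmetric]) auto
  have L2: "2 * pi * d / h = L"
  proof -
    have "2 * pi * d = L * h" using hh \<mu> n1 unfolding L1[symmetric] by (simp add: field_simps power2_eq_square)
    thus ?thesis using h by simp
  qed
  have M: "0 \<le> M" "\<mu> * real n \<le> \<alpha> * of_int M"
  proof -
    show "\<mu> * real n \<le> \<alpha> * of_int M"
    proof (cases "\<mu> = \<alpha>")
      case False
      hence "\<mu> = \<beta>" by (auto simp: \<mu>_def min_def split: if_splits)
      thus ?thesis using False le_mult_ceiling_divide[OF pos(1)] by (simp add: M_def)
    qed (simp add: M_def)
    have "0 \<le> \<beta> * real n / \<alpha>" using pos by simp
    thus "0 \<le> M" by (simp add: M_def)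
  qed
  have N: "0 \<le> N" "\<mu> * real n \<le> \<beta> * of_int N"
  proof -
    show "\<mu> * real n \<le> \<beta> * of_int N"
    proof (cases "\<mu> = \<alpha>")
      case True
      thus ?thesis using le_mult_ceiling_divide[OF pos(2)] by (simp add: N_def)
    next
      case False
      thus ?thesis using \<mu> by (simp add: N_def mult_right_mono)
    qed
    have "0 \<le> \<alpha> * real n / \<beta>" using pos by simp
    thus "0 \<le> N" by (simp add: N_def)
  qed
  have eM: "exp (- \<alpha> * (of_int M * h)) \<le> exp (- L)" "exp (- \<beta> * (of_int N * h)) \<le> exp (- L)"
    using mult_right_mono[OF M(2) less_imp_le[OF h]] mult_right_mono[OF N(2) less_imp_le[OF h]]
    unfolding L1 by (simp_all add: mult.assoc)
  let ?r1 = "exp (- sqrt (2 * pi * d * \<mu>))"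
  \<comment> \<open>From n \<ge> 1 follows L \<ge> sqrt(2 pi d \<mu>), so the denominator 1 -
    exp(-L) can be replaced by a constant free of n.\<close>
  have r: "exp (- L) \<le> ?r1" "?r1 < 1"
    using d \<mu> n1 mult_left_mono[OF n1, of "2 * pi * d * \<mu>"] by (simp_all add: L_def)
  have inv: "1 / \<alpha> + 1 / \<beta> \<le> 2 / \<mu>" "0 \<le> 1 / \<alpha> + 1 / \<beta>"
    using divide_left_mono[OF \<mu>(2), of 1] divide_left_mono[OF \<mu>(3), of 1] \<mu> pos by auto
  have "norm (integral {0<..} (\<lambda>t. f (of_real t)) - of_real h * (\<Sum>k = -M..N. F (of_real (of_int k * h))))
     \<le> 2 * (exp (- (2 * pi * d / h)) / (1 - exp (- (2 * pi * d / h))) * (A * (1 / \<alpha> + 1 / \<beta>)))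
        + B * (exp (- \<alpha> * (of_int M * h)) / \<alpha> + exp (- \<beta> * (of_int N * h)) / \<beta>)"
    by (rule sinc_quadrature_error[OF holo d h pos M(1) N(1) _ _ sl(2)])
       (use bound bound_real in \<open>auto simp: F_def\<close>)
  also have "\<dots> \<le> 2 * (exp (- L) / (1 - ?r1) * (A * (2 / \<mu>))) + B * (exp (- L) * (2 / \<mu>))"
  proof (rule add_mono)
    show "2 * (exp (- (2 * pi * d / h)) / (1 - exp (- (2 * pi * d / h))) * (A * (1 / \<alpha> + 1 / \<beta>)))
        \<le> 2 * (exp (- L) / (1 - ?r1) * (A * (2 / \<mu>)))"
      unfolding L2 using r inv pos by (intro mult_left_mono mult_mono frac_le) auto
    have "exp (- \<alpha> * (of_int M * h)) / \<alpha> + exp (- \<beta> * (of_int N * h)) / \<beta> \<le> exp (- L) / \<alpha> + exp (- L) / \<beta>"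
      using eM pos by (intro add_mono divide_right_mono) auto
    also have "\<dots> = exp (- L) * (1 / \<alpha> + 1 / \<beta>)" by (simp add: distrib_left)
    also have "\<dots> \<le> exp (- L) * (2 / \<mu>)" using inv by (intro mult_left_mono) auto
    finally show "B * (exp (- \<alpha> * (of_int M * h)) / \<alpha> + exp (- \<beta> * (of_int N * h)) / \<beta>) \<le> B * (exp (- L) * (2 / \<mu>))"
      using pos by (intro mult_left_mono) auto
  qed
  also have "\<dots> = 2 / \<mu> * (2 * A / (1 - ?r1) + B) * exp (- L)" by (simp add: algebra_simps)
  finally show "norm (integral {0<..} (\<lambda>t. f (of_real t))
           - of_real h * (\<Sum>k = -M..N. f (\<Psi> (of_real (of_int k * h))) * deriv \<Psi> (of_real (of_int k * h))))
         \<le> 2 / \<mu> * (2 * A / (1 - ?r1) + B) * exp (- sqrt (2 * pi * d * \<mu> * real n))"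
    by (simp add: F_def L_def)
qed

subsection \<open>The error bound\<close>

lemma psi_2: "psi 2 = exp" and psi_3: "psi 3 = (\<lambda>z. arsinh (exp z))"
  by (auto simp: psi_def)

lemma has_field_derivative_psi_3:
  assumes "\<zeta> \<in> strip d" "0 < d" "d < pi / 2"
  shows "(psi 3 has_field_derivative exp \<zeta> / cosh (arsinh (exp \<zeta>))) (at \<zeta>)"
  using DERIV_chain2[OF arsinh_complex_right_half_plane(4)[OF Re_exp_strip(2)[OF assms]] DERIV_exp]
  by (simp add: psi_3)

lemma of_real_in_strip: "0 < d \<Longrightarrow> complex_of_real x \<in> strip d"
  by (simp add: strip_def)

lemma le_mult_ge_one: "1 \<le> a \<Longrightarrow> 0 \<le> b \<Longrightarrow> b \<le> a * b" for a b :: real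
  using mult_right_mono[of 1 a b] by simp

text \<open>This matches the shape of \<open>C_const\<close> with the bound of
  \<open>mapped_sinc_quadrature_error\<close>: X is the power of cos d, r the exponential
  denominator, b the real-axis factor, and a is 1 for \<open>psi 2\<close> and
  \<open>2 powr (\<beta> / 2) * c_ad \<alpha> d\<close> for \<open>psi 3\<close>.\<close>

lemma quadrature_constant_eq:
  "2 * K / m * (2 * a / (r * X) + b) = 2 / m * (2 * (K * (a * (1 / X))) / r + K * b)" for K m a r X b :: real
proof -
  have "2 * (K * (a * (1 / X))) / r + K * b = K * (2 * a / (r * X) + b)"
    by (simp add: distrib_left mult.commute)
  thus ?thesis by simp
qed

theorem theorem4:
  fixes f :: "complex \<Rightarrow> complex" and d K \<alpha> \<beta> :: real and i n :: nat
  assumes "0 < d" "d < pi / 2"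
    and "i \<in> {2, 3}"
    and "f analytic_on (psi i ` strip d)"
    and "0 < K" "0 < \<alpha>" "0 < \<beta>"
    and "\<And>z. z \<in> psi i ` strip d \<Longrightarrow> norm (f z) \<le> K * norm (E i z \<alpha> \<beta>)"
    and "0 < n"
  shows "let \<mu> = min \<alpha> \<beta>;
             h = sqrt (2 * pi * d / (\<mu> * real n));
             M = (if \<mu> = \<alpha> then int n else \<lceil>\<beta> * real n / \<alpha>\<rceil>);
             N = (if \<mu> = \<alpha> then \<lceil>\<alpha> * real n / \<beta>\<rceil> else int n)
         in (\<lambda>t. f (of_real t)) integrable_on {0<..} \<and>
            norm (integral {0<..} (\<lambda>t. f (of_real t))
                  - of_real h * (\<Sum>k = -M..N. f (psi i (of_real (of_int k * h)))
                                              * deriv (psi i) (of_real (of_int k * h))))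
            \<le> C_const i K \<alpha> \<beta> d * exp (- sqrt (2 * pi * d * \<mu> * real n))"
proof -
  have cd: "0 < cos d" using assms(1,2) by (intro cos_gt_zero) auto
  let ?p = "(\<alpha> + \<beta>) / 2"
  let ?r = "exp (- sqrt (2 * pi * d * min \<alpha> \<beta>))"
  have fb: "norm (f (psi i \<zeta>) * D) \<le> K * c * b"
    if "\<zeta> \<in> strip d" "norm (E i (psi i \<zeta>) \<alpha> \<beta>) * norm D \<le> c * b" for \<zeta> D c b
  proof -
    have "norm (f (psi i \<zeta>) * D) \<le> K * norm (E i (psi i \<zeta>) \<alpha> \<beta>) * norm D"
      unfolding norm_mult using that(1) by (intro mult_right_mono assms(8)) auto
    also have "\<dots> \<le> K * (c * b)" using that(2) assms(5) by (simp add: mult.assoc)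
    finally show ?thesis by (simp add: mult.assoc)
  qed
  consider "i = 2" | "i = 3" using assms(3) by auto
  thus ?thesis
  proof cases
    case 1
    have dpsi: "deriv (psi 2) \<zeta> = exp \<zeta>" for \<zeta> by (simp add: psi_2 DERIV_imp_deriv)
    define A where "A = K * cos d powr (- ?p)"
    have bd: "norm (f (psi i \<zeta>) * deriv (psi i) \<zeta>) \<le> A * decay \<alpha> \<beta> (Re \<zeta>)" if "\<zeta> \<in> strip d" for \<zeta>
      unfolding A_def using fb[OF that] E2_bound[OF Re_exp_strip(1)[OF that assms(1,2)] cd assms(6,7)]
      by (simp add: 1 dpsi) (simp add: psi_2)
    \<comment> \<open>At real points Re (exp x) = |exp x|, so \<open>E2_bound\<close> applies with
      \<kappa> = 1.\<close>
    have bdr: "norm (f (psi i (of_real x)) * deriv (psi i) (of_real x)) \<le> K * decay \<alpha> \<beta> x" for x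
    proof -
      have "norm (E 2 (exp (of_real x)) \<alpha> \<beta>) * norm (exp (complex_of_real x)) \<le> 1 powr (- ?p) * decay \<alpha> \<beta> (Re (complex_of_real x))"
        by (rule E2_bound) (use assms(6,7) in \<open>auto simp: exp_of_real\<close>)
      thus ?thesis using fb[OF of_real_in_strip[OF assms(1)], of x "exp (of_real x)" 1]
        by (simp add: 1 dpsi) (simp add: psi_2)
    qed
    have an: "psi i analytic_on strip d" unfolding 1 psi_2 by (intro analytic_intros)
    have C: "C_const i K \<alpha> \<beta> d = 2 / min \<alpha> \<beta> * (2 * A / (1 - ?r) + K)"
      using quadrature_constant_eq[of K "min \<alpha> \<beta>" 1 "1 - ?r" "cos d powr ?p" 1]
      by (simp only: C_const_def Let_def 1 A_def powr_minus_divide simp_thms if_True mult_1 mult_1_right)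
    have "0 \<le> A" "0 \<le> K" using assms(5) by (simp_all add: A_def)
    moreover have "psi i (of_real x) = of_real (exp x)" "deriv (psi i) (of_real x) = of_real (exp x)" for x
      by (simp_all only: 1 dpsi exp_of_real) (simp add: psi_2 exp_of_real)
    moreover have "\<exists>x. exp x = t" if "0 < t" for t :: real using exp_ln[OF that] by blast
    ultimately have Q: "0 \<le> A" "0 \<le> K" "\<And>x. psi i (of_real x) = of_real (exp x)"
      "\<And>x. deriv (psi i) (of_real x) = of_real (exp x)" "\<And>t::real. 0 < t \<Longrightarrow> \<exists>x. exp x = t" by blast+
    note Q' = mapped_sinc_quadrature_error[OF assms(1,6,7) Q(1,2) assms(9) an assms(4) bd bdr Q(3,4)
        DERIV_exp exp_ge_zero exp_gt_zero Q(5) exp_at_top exp_at_bot]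
    show ?thesis unfolding Let_def C by (intro conjI Q')
  next
    case 2
    have three_ne_two: "(3 = (2::nat)) = False" by simp
    have dpsi: "deriv (psi 3) \<zeta> = exp \<zeta> / cosh (arsinh (exp \<zeta>))" if "\<zeta> \<in> strip d" for \<zeta>
      using has_field_derivative_psi_3[OF that assms(1,2)] by (rule DERIV_imp_deriv)
    \<comment> \<open>Of the factor 2^(1+\<beta>/2) in \<open>C_const\<close>, only 2^(\<beta>/2)
      belongs here; the remaining 2 counts the two edges of the strip.\<close>
    define c where "c = 2 powr (\<beta> / 2) * c_ad \<alpha> d * cos d powr (- ?p)"
    define B where "B = K * 2 powr ((1 - \<alpha> + \<bar>1 - \<alpha>\<bar>) / 2)"
    have nn: "0 \<le> c_ad \<alpha> d" by (simp add: c_ad_def)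
    have bd: "norm (f (psi i \<zeta>) * deriv (psi i) \<zeta>) \<le> K * c * decay \<alpha> \<beta> (Re \<zeta>)" if "\<zeta> \<in> strip d" for \<zeta>
    proof (rule fb[OF that])
      have "norm (E i (psi i \<zeta>) \<alpha> \<beta>) * norm (deriv (psi i) \<zeta>) \<le> c_ad \<alpha> d * cos d powr (- ?p) * decay \<alpha> \<beta> (Re \<zeta>)"
        using E3_bound[OF that assms(1,2,6,7)] unfolding 2 dpsi[OF that] by (simp add: psi_3)
      \<comment> \<open>The inserted factor is at least 1 and brings the bound to the form used in
        \<open>C_const\<close>.\<close>
      also have "\<dots> \<le> 2 powr (\<beta> / 2) * (c_ad \<alpha> d * cos d powr (- ?p) * decay \<alpha> \<beta> (Re \<zeta>))"
        using nn assms(7) ge_one_powr_ge_zero[of 2 "\<beta> / 2"]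
        by (intro le_mult_ge_one) (auto simp: decay_def)
      finally show "norm (E i (psi i \<zeta>) \<alpha> \<beta>) * norm (deriv (psi i) \<zeta>) \<le> c * decay \<alpha> \<beta> (Re \<zeta>)"
        by (simp add: c_def mult.assoc)
    qed
    have psi_r: "psi i (of_real x) = of_real (arsinh (exp x))" for x
      by (simp add: 2 psi_3 exp_of_real arsinh_of_real)
    have dpsi_r: "deriv (psi i) (of_real x) = of_real (exp x / cosh (arsinh (exp x)))" for x
      using dpsi[OF of_real_in_strip[OF assms(1)], of x]
      by (simp add: 2 exp_of_real arsinh_of_real cosh_complex_of_real)
    have bdr: "norm (f (psi i (of_real x)) * deriv (psi i) (of_real x)) \<le> B * decay \<alpha> \<beta> x" for x
      unfolding B_def
    proof (rule fb[OF of_real_in_strip[OF assms(1)]])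
      show "norm (E i (psi i (of_real x)) \<alpha> \<beta>) * norm (deriv (psi i) (of_real x)) \<le> 2 powr ((1 - \<alpha> + \<bar>1 - \<alpha>\<bar>) / 2) * decay \<alpha> \<beta> x"
        using E3_bound_real[OF assms(6,7), of x] dpsi[OF of_real_in_strip[OF assms(1)], of x] psi_r[of x]
        by (simp add: 2 exp_of_real arsinh_of_real)
    qed
    have an: "psi i analytic_on strip d" unfolding analytic_on_open[OF open_strip] 2
      using has_field_derivative_psi_3[OF _ assms(1,2)] by (auto simp: holomorphic_on_open[OF open_strip])
    have C: "C_const i K \<alpha> \<beta> d = 2 / min \<alpha> \<beta> * (2 * (K * c) / (1 - ?r) + B)"
    proof -
      have "2 powr (1 + \<beta> / 2) * c_ad \<alpha> d = 2 * (2 powr (\<beta> / 2) * c_ad \<alpha> d)" by (simp add: powr_add)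
      thus ?thesis
        using quadrature_constant_eq[of K "min \<alpha> \<beta>" "2 powr (\<beta> / 2) * c_ad \<alpha> d" "1 - ?r" "cos d powr ?p"
            "2 powr ((1 - \<alpha> + \<bar>1 - \<alpha>\<bar>) / 2)"] three_ne_two
        by (simp only: C_const_def Let_def 2 c_def B_def powr_minus_divide if_False mult.assoc)
    qed
    have der: "((\<lambda>x. arsinh (exp x)) has_real_derivative exp x / cosh (arsinh (exp x))) (at x)" for x :: real
      using DERIV_chain2[OF arsinh_real_has_field_derivative DERIV_exp, of x] by (simp add: cosh_arsinh_real)
    have top: "filterlim (\<lambda>x. arsinh (exp x) :: real) at_top at_top"
      by (rule filterlim_compose[OF arsinh_real_at_top exp_at_top])
    have bot: "((\<lambda>x. arsinh (exp x) :: real) \<longlongrightarrow> 0) at_bot"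
      using tendsto_arsinh[OF exp_at_bot] by simp
    have surj: "\<exists>x. arsinh (exp x) = t" if "0 < t" for t :: real
      using that by (intro exI[of _ "ln (sinh t)"]) (simp add: arsinh_sinh_real)
    have nonneg: "0 \<le> exp x / cosh (arsinh (exp x))" "0 < arsinh (exp x)" for x :: real by simp_all
    have nn': "0 \<le> K * c" "0 \<le> B" using assms(5) nn by (simp_all add: c_def B_def)
    note Q' = mapped_sinc_quadrature_error[OF assms(1,6,7) nn' assms(9) an assms(4) bd bdr psi_r dpsi_r
        der nonneg surj top bot]
    show ?thesis unfolding Let_def C by (intro conjI Q')
  qed
qed

end
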